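(* Let $f, p_1,\ldots,p_{n_p}\in\mathbb{R}[x]$ be univariate real polynomials such that $K:=\{x\in\mathbb{R} : p_i(x)\ge 0,\ i=1,\ldots,n_p\}$ is bounded and non-empty. Let $f^*:=\min_{x\in K} f(x)$ and, for each order $r$, let $f_r$ be the value of the order-$r$ SOS relaxation and $e_r:=f^*-f_r$ the relaxation error. Then there exist constants $C>0$ and $r_0\in\mathbb{N}$ (depending on $f,p_1,\ldots,p_{n_p}$) such that $$0\le e_r\le \frac{C}{r^2}\qquad\text{for all } r\ge r_0.$$
   Context: Let $\Sigma[x]\subset\mathbb{R}[x]$ be the cone of sums of squares of univariate polynomials and $p_0:=1$. For $r\in\mathbb{N}$ with $2r\ge\max\{\deg f,\deg p_1,\ldots,\deg p_{n_p}\}$, the truncated quadratic module is $$\mathcal{Q}_r(p):=\Big\{\sum_{i=0}^{n_p}\sigma_i p_i :\ \sigma_i\in\Sigma[x],\ \deg(\sigma_i p_i)\le 2r\Big\},$$ with the zero polynomial regarded as satisfying every degree bound. The value of the order-$r$ SOS relaxation is $$f_r:=\sup\{v\in\mathbb{R} :\ f-v\in\mathcal{Q}_r(p)\}.$$ *)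

theory Defs
  imports "HOL-Analysis.Analysis" "HOL-Computational_Algebra.Polynomial"
begin

text \<open>
  The constraint polynomials are \<open>p 1, \<dots>, p np\<close>; the value of \<open>p\<close> at any other index is irrelevant.
\<close>

definition feasible_set :: "nat \<Rightarrow> (nat \<Rightarrow> real poly) \<Rightarrow> real set" where
  "feasible_set np p = {x. \<forall>i\<in>{1..np}. poly (p i) x \<ge> 0}"

definition sos_polys :: "real poly set" where
  "sos_polys = {\<sigma>. \<exists>qs. \<sigma> = (\<Sum>q\<leftarrow>qs. q\<^sup>2)}"

text \<open>The constraints extended by \<open>p\<^sub>0 = 1\<close>, irrespective of the value \<open>p 0\<close>.\<close>

definition with_one :: "(nat \<Rightarrow> real poly) \<Rightarrow> nat \<Rightarrow> real poly" where
  "with_one p = p(0 := 1)"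

text \<open>Since \<open>degree 0 = 0\<close>, the zero polynomial satisfies every degree bound below.\<close>

definition truncated_quadratic_module ::
    "nat \<Rightarrow> (nat \<Rightarrow> real poly) \<Rightarrow> nat \<Rightarrow> real poly set" where
  "truncated_quadratic_module np p r =
     {\<Sum>i=0..np. \<sigma> i * with_one p i | \<sigma>.
        \<forall>i\<in>{0..np}. \<sigma> i \<in> sos_polys \<and> degree (\<sigma> i * with_one p i) \<le> 2 * r}"

text \<open>The orders \<open>r\<close> for which the relaxation is considered.\<close>

definition admissible_order :: "real poly \<Rightarrow> nat \<Rightarrow> (nat \<Rightarrow> real poly) \<Rightarrow> nat \<Rightarrow> bool" where
  "admissible_order f np p r \<longleftrightarrow> Max (insert (degree f) ((\<lambda>i. degree (p i)) ` {1..np})) \<le> 2 * r"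

text \<open>
  The supremum is taken in the extended reals, so that it is \<open>-\<infinity>\<close> when no \<open>v\<close> is feasible
  (the supremum of the empty set in type \<open>real\<close> would be meaningless).
\<close>

definition sos_value :: "real poly \<Rightarrow> nat \<Rightarrow> (nat \<Rightarrow> real poly) \<Rightarrow> nat \<Rightarrow> ereal" where
  "sos_value f np p r =
     Sup {ereal v | v. f - [:v:] \<in> truncated_quadratic_module np p r}"

text \<open>The minimum itself, not an infimum: \<open>LEAST\<close> selects the least element of the set of values.\<close>

definition min_value :: "real poly \<Rightarrow> nat \<Rightarrow> (nat \<Rightarrow> real poly) \<Rightarrow> real" where
  "min_value f np p = (LEAST y. y \<in> poly f ` feasible_set np p)"

definition relaxation_error :: "real poly \<Rightarrow> nat \<Rightarrow> (nat \<Rightarrow> real poly) \<Rightarrow> nat \<Rightarrow> ereal" where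
  "relaxation_error f np p r = ereal (min_value f np p) - sos_value f np p r"

end

theory Submission
  imports Defs
begin

text \<open>
  After subtracting the minimum one may assume \<open>f \<ge> 0\<close> on the feasible set \<open>K\<close>, and it suffices to show that
  \<open>f + C / n\<^sup>2\<close> lies in the truncated quadratic module of order \<open>D n\<close> for every \<open>n \<ge> 1\<close>
  (\<open>quadratic_rate_certificate\<close>). A univariate polynomial that is nonnegative on the whole line is a
  sum of squares (\<open>sos_polys_iff_nonneg\<close>). So it is enough to find members \<open>G\<^sub>n\<close> of the module, of degree
  \<open>O(n)\<close>, with \<open>G\<^sub>n \<le> f + C / n\<^sup>2\<close> everywhere: they have to be very negative where \<open>f\<close> is, and small
  where \<open>f\<close> is nonnegative.

  Such polynomials are first built near a single point \<open>a\<close>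
  (\<open>local_certificate_exists\<close>); only points near which \<open>f\<close> takes negative values matter. If some element of
  the module is negative on both sides of \<open>a\<close>, a large multiple of it does the job. Otherwise \<open>f\<close> and
  some constraint \<open>p\<close> both change sign at \<open>a\<close>, in the same direction. Let \<open>z\<close> be the coordinate at \<open>a\<close>
  for which both are positive when \<open>z > 0\<close>, so that \<open>f\<close> behaves like \<open>z\<^sup>m\<close> and \<open>p\<close> like \<open>z\<^sup>k\<close>; after
  multiplication of \<open>p\<close> by an even power of \<open>z\<close>, \<open>m < k\<close>. Up to an error near \<open>z = 0\<close>, the
  multiplier of \<open>p\<close> must be at most of size \<open>z\<^sup>m\<^sup>-\<^sup>k\<close> for \<open>z > 0\<close> and at least of this size for
  \<open>z < 0\<close>. A power of the \<open>n\<close>-th Fejer kernel, a polynomial bounded by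
  \<open>2 / z\<close> on \<open>(0, 2]\<close> and at least \<open>n\<^sup>2\<close> for \<open>z \<le> 0\<close>, achieves this outside a zone of
  width \<open>O(1 / n\<^sup>2)\<close>. There \<open>f\<close> itself is at least \<open>- O(1 / n\<^sup>2)\<close>, and this is the rate of the theorem
  (\<open>local_certificate_higher_odd_order\<close>).

  Away from \<open>a\<close> these multipliers are exponentially large in \<open>n\<close>. A power of a quadratic polynomial, with an
  exponent proportional to \<open>n\<close>, makes them exponentially small there without
  disturbing the inequalities near \<open>a\<close> (\<open>localizing_family\<close>). A finite subcover then settles any bounded
  interval (\<open>interval_certificate\<close>). Outside of a large interval the boundedness of \<open>K\<close>
  provides an element of the module that is negative at infinity; multiplied with a high even power of \<open>x\<close> it dominates
  everything else (\<open>negative_element_at_infinity\<close>, \<open>dominating_family_at_infinity\<close>).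
\<close>

section \<open>Nonnegative univariate polynomials are sums of squares\<close>

lemma poly_nonneg_at_limit:
  fixes q :: "real poly"
  assumes "\<And>x. x \<noteq> a \<Longrightarrow> 0 \<le> poly q x"
  shows "0 \<le> poly q a"
proof (rule tendsto_lowerbound)
  show "(poly q \<longlongrightarrow> poly q a) (at a)"
    using isCont_def poly_isCont by blast
  show "\<forall>\<^sub>F x in at a. 0 \<le> poly q x"
    using assms by (simp add: eventually_at_filter)
qed simp

lemma nonneg_poly_attains_min:
  fixes q :: "real poly"
  assumes nonneg: "\<And>x. 0 \<le> poly q x" and "degree q > 0"
  obtains x0 where "\<And>x. poly q x0 \<le> poly q x"
proof -
  have "filterlim (poly q) at_infinity at_infinity"
    using assms(2) by (rule filterlim_poly_at_infinity)
  then have "\<forall>\<^sub>F x in at_infinity. poly q 0 \<le> norm (poly q x)"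
    by (simp add: filterlim_at_infinity_conv_norm_at_top filterlim_at_top)
  then obtain b where b: "\<And>x. b \<le> norm x \<Longrightarrow> poly q 0 \<le> norm (poly q x)"
    unfolding eventually_at_infinity by blast
  have "compact {- \<bar>b\<bar>..\<bar>b\<bar>}" "{- \<bar>b\<bar>..\<bar>b\<bar>} \<noteq> {}"
    by auto
  then obtain x0 where x0: "x0 \<in> {- \<bar>b\<bar>..\<bar>b\<bar>}" "\<And>x. x \<in> {- \<bar>b\<bar>..\<bar>b\<bar>} \<Longrightarrow> poly q x0 \<le> poly q x"
    using continuous_attains_inf[of "{- \<bar>b\<bar>..\<bar>b\<bar>}" "poly q"]
      continuous_on_poly[OF continuous_on_id] by (metis (no_types))
  have "poly q x0 \<le> poly q x" for x
  proof (cases "x \<in> {- \<bar>b\<bar>..\<bar>b\<bar>}")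
    case False
    then have "poly q 0 \<le> poly q x"
      using b[of x] nonneg[of x] by auto
    moreover have "poly q x0 \<le> poly q 0"
      by (rule x0(2)) auto
    ultimately show ?thesis by simp
  qed (use x0 in blast)
  then show thesis by (rule that)
qed

text \<open>
  Subtracting the minimum \<open>\<mu> = q(x\<^sub>0)\<close> creates a root \<open>x\<^sub>0\<close> of multiplicity at least two, so that
  \<open>q = (x - x\<^sub>0)\<^sup>2 q\<^sub>2 + \<mu>\<close> with \<open>q\<^sub>2\<close> again nonnegative and of smaller degree. From here on, membership in
  the cone of sums of squares is treated as pointwise nonnegativity.
\<close>
theorem sos_polys_iff_nonneg: "q \<in> sos_polys \<longleftrightarrow> (\<forall>x. 0 \<le> poly q x)"
proof
  assume "q \<in> sos_polys"
  then obtain qs where "q = (\<Sum>q\<leftarrow>qs. q\<^sup>2)"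
    unfolding sos_polys_def by blast
  moreover have "0 \<le> poly (\<Sum>q\<leftarrow>qs. q\<^sup>2) x" for qs :: "real poly list" and x
    by (induction qs) auto
  ultimately show "\<forall>x. 0 \<le> poly q x" by blast
next
  assume "\<forall>x. 0 \<le> poly q x"
  then show "q \<in> sos_polys"
  proof (induction "degree q" arbitrary: q rule: less_induct)
    case less
    show ?case
    proof (cases "degree q = 0")
      case True
      then obtain c where c: "q = [:c:]"
        by (rule degree_eq_zeroE)
      with less.prems have "c \<ge> 0" by simp
      then have "q = (\<Sum>q\<leftarrow>[[:sqrt c:]]. q\<^sup>2)"
        using c by (simp add: power2_eq_square)
      then show ?thesis unfolding sos_polys_def by blast
    next
      case False
      then obtain x0 where x0: "\<And>x. poly q x0 \<le> poly q x"
        using nonneg_poly_attains_min[of q] less.prems by blast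
      define \<mu> where "\<mu> = poly q x0"
      have "poly (q - [:\<mu>:]) x0 = 0" by (simp add: \<mu>_def)
      then obtain q1 where q1: "q - [:\<mu>:] = [:-x0, 1:] * q1"
        unfolding poly_eq_0_iff_dvd by (elim dvdE)
      have "poly (pderiv q) x0 = 0"
        by (rule DERIV_local_min[where d = 1, OF poly_DERIV]) (use x0 in auto)
      moreover have "pderiv q = pderiv (q - [:\<mu>:])"
        by (simp add: pderiv_diff pderiv_pCons)
      ultimately have "poly q1 x0 = 0"
        unfolding q1 by (simp add: pderiv_mult pderiv_pCons del: mult_pCons_left)
      then obtain q2 where q2: "q1 = [:-x0, 1:] * q2"
        unfolding poly_eq_0_iff_dvd by (elim dvdE)
      have q_eq: "q = [:-x0, 1:]\<^sup>2 * q2 + [:\<mu>:]"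
        using q1 unfolding q2 by (simp add: power2_eq_square mult.assoc diff_eq_eq del: mult_pCons_left)
      have "0 \<le> poly q2 x" if "x \<noteq> x0" for x
      proof -
        have "0 \<le> (x - x0)\<^sup>2 * poly q2 x"
          using x0[of x] arg_cong[OF q_eq, of "\<lambda>q. poly q x"] by (simp add: \<mu>_def power2_eq_square algebra_simps)
        then show ?thesis using that by (simp add: zero_le_mult_iff)
      qed
      then have nonneg2: "\<forall>x. 0 \<le> poly q2 x"
        using poly_nonneg_at_limit by metis
      have "q2 \<noteq> 0"
        using False q_eq by auto
      then have "degree (q - [:\<mu>:]) = Suc (Suc (degree q2))"
        unfolding q1 q2 by (simp add: degree_mult_eq del: mult_pCons_left)
      then have "degree q2 < degree q"
        using degree_diff_le[of q "degree q" "[:\<mu>:]"] by simp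
      from less.hyps[OF this nonneg2] obtain qs where qs: "q2 = (\<Sum>q\<leftarrow>qs. q\<^sup>2)"
        unfolding sos_polys_def by blast
      have "\<mu> \<ge> 0" using less.prems \<mu>_def by simp
      have "(\<Sum>q\<leftarrow>map ((*) l) qs. q\<^sup>2) = l\<^sup>2 * (\<Sum>q\<leftarrow>qs. q\<^sup>2)" for l
        by (induction qs) (simp_all add: power_mult_distrib distrib_left)
      then have "q = (\<Sum>q\<leftarrow>[:sqrt \<mu>:] # map ((*) [:-x0, 1:]) qs. q\<^sup>2)"
        using q_eq \<open>\<mu> \<ge> 0\<close> unfolding qs by (simp add: power2_eq_square del: mult_pCons_left)
      then show ?thesis unfolding sos_polys_def by blast
    qed
  qed
qed

section \<open>Closure properties of the truncated quadratic module\<close>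

lemma truncated_quadratic_moduleI:
  assumes "h = (\<Sum>i=0..np. \<sigma> i * with_one p i)"
    and "\<And>i. i \<le> np \<Longrightarrow> \<sigma> i \<in> sos_polys"
    and "\<And>i. i \<le> np \<Longrightarrow> degree (\<sigma> i * with_one p i) \<le> 2 * r"
  shows "h \<in> truncated_quadratic_module np p r"
  using assms unfolding truncated_quadratic_module_def by auto

lemma truncated_quadratic_moduleE:
  assumes "h \<in> truncated_quadratic_module np p r"
  obtains \<sigma> where "h = (\<Sum>i=0..np. \<sigma> i * with_one p i)"
    and "\<And>i. i \<le> np \<Longrightarrow> \<sigma> i \<in> sos_polys"
    and "\<And>i. i \<le> np \<Longrightarrow> degree (\<sigma> i * with_one p i) \<le> 2 * r"
  using assms unfolding truncated_quadratic_module_def by auto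

lemma truncated_quadratic_module_mono:
  assumes "h \<in> truncated_quadratic_module np p r" "r \<le> s"
  shows "h \<in> truncated_quadratic_module np p s"
  using assms(1)
proof (elim truncated_quadratic_moduleE)
  fix \<sigma> assume "h = (\<Sum>i=0..np. \<sigma> i * with_one p i)" "\<And>i. i \<le> np \<Longrightarrow> \<sigma> i \<in> sos_polys"
    and *: "\<And>i. i \<le> np \<Longrightarrow> degree (\<sigma> i * with_one p i) \<le> 2 * r"
  moreover have "degree (\<sigma> i * with_one p i) \<le> 2 * s" if "i \<le> np" for i
    using *[OF that] assms(2) by linarith
  ultimately show ?thesis
    by (intro truncated_quadratic_moduleI)
qed

lemma truncated_quadratic_module_add:
  assumes "h1 \<in> truncated_quadratic_module np p r" "h2 \<in> truncated_quadratic_module np p r"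
  shows "h1 + h2 \<in> truncated_quadratic_module np p r"
proof -
  obtain \<sigma> where \<sigma>: "h1 = (\<Sum>i=0..np. \<sigma> i * with_one p i)" "\<And>i. i \<le> np \<Longrightarrow> \<sigma> i \<in> sos_polys"
      "\<And>i. i \<le> np \<Longrightarrow> degree (\<sigma> i * with_one p i) \<le> 2 * r"
    using assms(1) by (rule truncated_quadratic_moduleE) blast
  obtain \<tau> where \<tau>: "h2 = (\<Sum>i=0..np. \<tau> i * with_one p i)" "\<And>i. i \<le> np \<Longrightarrow> \<tau> i \<in> sos_polys"
      "\<And>i. i \<le> np \<Longrightarrow> degree (\<tau> i * with_one p i) \<le> 2 * r"
    using assms(2) by (rule truncated_quadratic_moduleE) blast
  show ?thesis
  proof (rule truncated_quadratic_moduleI[where \<sigma> = "\<lambda>i. \<sigma> i + \<tau> i"])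
    show "h1 + h2 = (\<Sum>i=0..np. (\<sigma> i + \<tau> i) * with_one p i)"
      by (simp add: \<sigma>(1) \<tau>(1) sum.distrib distrib_right)
    show "\<sigma> i + \<tau> i \<in> sos_polys" if "i \<le> np" for i
      using \<sigma>(2)[OF that] \<tau>(2)[OF that] by (simp add: sos_polys_iff_nonneg)
    show "degree ((\<sigma> i + \<tau> i) * with_one p i) \<le> 2 * r" if "i \<le> np" for i
      using degree_add_le[OF \<sigma>(3)[OF that] \<tau>(3)[OF that]] by (simp add: distrib_right)
  qed
qed

lemma truncated_quadratic_module_sos_mult:
  assumes "h \<in> truncated_quadratic_module np p r" "w \<in> sos_polys" "degree w \<le> 2 * d"
  shows "w * h \<in> truncated_quadratic_module np p (d + r)"
proof -
  obtain \<sigma> where \<sigma>: "h = (\<Sum>i=0..np. \<sigma> i * with_one p i)" "\<And>i. i \<le> np \<Longrightarrow> \<sigma> i \<in> sos_polys"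
      "\<And>i. i \<le> np \<Longrightarrow> degree (\<sigma> i * with_one p i) \<le> 2 * r"
    using assms(1) by (rule truncated_quadratic_moduleE) blast
  show ?thesis
  proof (rule truncated_quadratic_moduleI[where \<sigma> = "\<lambda>i. w * \<sigma> i"])
    show "w * h = (\<Sum>i=0..np. w * \<sigma> i * with_one p i)"
      by (simp add: \<sigma>(1) sum_distrib_left mult.assoc)
    show "w * \<sigma> i \<in> sos_polys" if "i \<le> np" for i
      using assms(2) \<sigma>(2)[OF that] by (simp add: sos_polys_iff_nonneg)
    show "degree (w * \<sigma> i * with_one p i) \<le> 2 * (d + r)" if "i \<le> np" for i
      using degree_mult_le[of w "\<sigma> i * with_one p i"] \<sigma>(3)[OF that] assms(3) by (simp add: mult.assoc)
  qed
qed

lemma truncated_quadratic_module_sos: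
  assumes "w \<in> sos_polys" "degree w \<le> 2 * r"
  shows "w \<in> truncated_quadratic_module np p r"
proof (rule truncated_quadratic_moduleI[where \<sigma> = "\<lambda>i. if i = 0 then w else 0"])
  show "w = (\<Sum>i = 0..np. (if i = 0 then w else 0) * with_one p i)"
    by (simp add: with_one_def if_distrib[where f = "\<lambda>q. q * _"] cong: if_cong)
qed (use assms in \<open>auto simp: sos_polys_iff_nonneg with_one_def\<close>)

lemma truncated_quadratic_module_generator:
  assumes "i \<in> {1..np}"
  shows "p i \<in> truncated_quadratic_module np p (degree (p i))"
proof (rule truncated_quadratic_moduleI[where \<sigma> = "\<lambda>j. if j = i then 1 else 0"])
  show "p i = (\<Sum>j = 0..np. (if j = i then 1 else 0) * with_one p j)"
    using assms by (simp add: with_one_def if_distrib[where f = "\<lambda>q. q * _"] cong: if_cong)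
qed (use assms in \<open>auto simp: sos_polys_iff_nonneg with_one_def\<close>)

lemma truncated_quadratic_module_nonneg_on_feasible:
  assumes "h \<in> truncated_quadratic_module np p r" "x \<in> feasible_set np p"
  shows "0 \<le> poly h x"
proof -
  obtain \<sigma> where \<sigma>: "h = (\<Sum>i=0..np. \<sigma> i * with_one p i)" "\<And>i. i \<le> np \<Longrightarrow> \<sigma> i \<in> sos_polys"
    using assms(1) by (rule truncated_quadratic_moduleE) blast
  have "0 \<le> poly (\<sigma> i) x * poly (with_one p i) x" if "i \<in> {0..np}" for i
    using \<sigma>(2)[of i] that assms(2)
    by (cases "i = 0") (auto simp: sos_polys_iff_nonneg with_one_def feasible_set_def)
  then show ?thesis
    unfolding \<sigma>(1) poly_sum poly_mult by (rule sum_nonneg)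
qed

section \<open>Families of exponential growth\<close>

text \<open>
  The correcting polynomials of index \<open>n\<close> have degree \<open>O(n)\<close> and are allowed to be exponentially large
  in \<open>n\<close>, because an exponentially small factor of degree \<open>O(n)\<close> can undo this away from the place
  where they are needed. The factor \<open>1 + x\<^sup>2\<close> also records the growth for \<open>x \<rightarrow> \<plusminus>\<infinity>\<close>, which matters
  when nonnegativity on a bounded interval is extended to the whole line. A single constant \<open>B\<close> for
  the degree, the base and the exponent makes the class closed under sums and products by merely
  enlarging \<open>B\<close>, and for \<open>n > 0\<close> it absorbs constant factors.
\<close>
definition exp_bounded :: "(nat \<Rightarrow> real poly) \<Rightarrow> bool" where
  "exp_bounded g \<longleftrightarrow>
     (\<exists>B::nat. \<forall>n>0. degree (g n) \<le> B * n \<and> (\<forall>x. \<bar>poly (g n) x\<bar> \<le> (real B * (1 + x\<^sup>2)) ^ (B * n)))"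

lemma exp_boundedI:
  assumes "\<And>n. n > 0 \<Longrightarrow> degree (g n) \<le> B * n"
    and "\<And>n x. n > 0 \<Longrightarrow> \<bar>poly (g n) x\<bar> \<le> (real B * (1 + x\<^sup>2)) ^ (B * n)"
  shows "exp_bounded g"
  using assms unfolding exp_bounded_def by blast

lemma exp_bound_mono:
  assumes "B \<le> B'"
  shows "(real B * (1 + x\<^sup>2)) ^ (B * n) \<le> (real B' * (1 + x\<^sup>2)) ^ (B' * n)"
proof (cases "B = 0")
  case True
  have "1 \<le> (real B' * (1 + x\<^sup>2)) ^ (B' * n)"
  proof (cases "B' = 0")
    case False
    then have "1 * 1 \<le> real B' * (1 + x\<^sup>2)"
      by (intro mult_mono) auto
    then show ?thesis by (simp add: one_le_power)
  qed simp
  then show ?thesis using True by simp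
next
  case False
  then have "1 * 1 \<le> real B' * (1 + x\<^sup>2)"
    using assms by (intro mult_mono) auto
  moreover have "real B * (1 + x\<^sup>2) \<le> real B' * (1 + x\<^sup>2)"
    using assms by (intro mult_right_mono) auto
  ultimately have "(real B * (1 + x\<^sup>2)) ^ (B * n) \<le> (real B' * (1 + x\<^sup>2)) ^ (B * n)"
    and "(real B' * (1 + x\<^sup>2)) ^ (B * n) \<le> (real B' * (1 + x\<^sup>2)) ^ (B' * n)"
    using assms by (auto intro!: power_mono power_increasing)
  then show ?thesis by linarith
qed

text \<open>
  The bound \<open>m\<close> can be prescribed, so that several families share one constant.
\<close>
lemma exp_boundedE:
  assumes "exp_bounded g"
  obtains B where "B \<ge> 1" "B \<ge> m" "\<And>n. n > 0 \<Longrightarrow> degree (g n) \<le> B * n"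
    and "\<And>n x. n > 0 \<Longrightarrow> \<bar>poly (g n) x\<bar> \<le> (real B * (1 + x\<^sup>2)) ^ (B * n)"
proof -
  obtain B where B: "\<And>n. n > 0 \<Longrightarrow> degree (g n) \<le> B * n"
    "\<And>n x. n > 0 \<Longrightarrow> \<bar>poly (g n) x\<bar> \<le> (real B * (1 + x\<^sup>2)) ^ (B * n)"
    using assms unfolding exp_bounded_def by blast
  define B' where "B' = max (max B m) 1"
  have "degree (g n) \<le> B' * n" if "n > 0" for n
    using B(1)[OF that] mult_le_mono1[of B B' n] unfolding B'_def by linarith
  moreover have "\<bar>poly (g n) x\<bar> \<le> (real B' * (1 + x\<^sup>2)) ^ (B' * n)" if "n > 0" for n x
    using B(2)[OF that, of x] exp_bound_mono[of B B' x n] unfolding B'_def by linarith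
  ultimately show thesis
    using that[of B'] by (simp add: B'_def)
qed

lemma exp_boundedE2:
  assumes "exp_bounded g" "exp_bounded h"
  obtains B where "B \<ge> 1" "\<And>n. n > 0 \<Longrightarrow> degree (g n) \<le> B * n" "\<And>n. n > 0 \<Longrightarrow> degree (h n) \<le> B * n"
    "\<And>n x. n > 0 \<Longrightarrow> \<bar>poly (g n) x\<bar> \<le> (real B * (1 + x\<^sup>2)) ^ (B * n)"
    "\<And>n x. n > 0 \<Longrightarrow> \<bar>poly (h n) x\<bar> \<le> (real B * (1 + x\<^sup>2)) ^ (B * n)"
proof -
  obtain B1 where B1: "B1 \<ge> 1" "\<And>n. n > 0 \<Longrightarrow> degree (g n) \<le> B1 * n"
    "\<And>n x. n > 0 \<Longrightarrow> \<bar>poly (g n) x\<bar> \<le> (real B1 * (1 + x\<^sup>2)) ^ (B1 * n)"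
    using exp_boundedE[OF assms(1)] by metis
  obtain B2 where B2: "B2 \<ge> B1" "\<And>n. n > 0 \<Longrightarrow> degree (h n) \<le> B2 * n"
    "\<And>n x. n > 0 \<Longrightarrow> \<bar>poly (h n) x\<bar> \<le> (real B2 * (1 + x\<^sup>2)) ^ (B2 * n)"
    using exp_boundedE[OF assms(2)] by metis
  have "degree (g n) \<le> B2 * n" if "n > 0" for n
    using B1(2)[OF that] mult_le_mono1[OF B2(1), of n] by linarith
  moreover have "\<bar>poly (g n) x\<bar> \<le> (real B2 * (1 + x\<^sup>2)) ^ (B2 * n)" if "n > 0" for n x
    using B1(3)[OF that, of x] exp_bound_mono[OF B2(1), of x n] by linarith
  ultimately show thesis
    using that[of B2] B1(1) B2 by fastforce
qed

lemma exp_bounded_add: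
  assumes "exp_bounded g" "exp_bounded h"
  shows "exp_bounded (\<lambda>n. g n + h n)"
proof -
  obtain B where B: "B \<ge> 1" "\<And>n. n > 0 \<Longrightarrow> degree (g n) \<le> B * n" "\<And>n. n > 0 \<Longrightarrow> degree (h n) \<le> B * n"
    "\<And>n x. n > 0 \<Longrightarrow> \<bar>poly (g n) x\<bar> \<le> (real B * (1 + x\<^sup>2)) ^ (B * n)"
    "\<And>n x. n > 0 \<Longrightarrow> \<bar>poly (h n) x\<bar> \<le> (real B * (1 + x\<^sup>2)) ^ (B * n)"
    by (rule exp_boundedE2[OF assms]) blast
  show ?thesis
  proof (rule exp_boundedI[where B = "2 * B"])
    fix n :: nat assume n: "n > 0"
    show "degree (g n + h n) \<le> 2 * B * n"
      using degree_add_le[OF B(2)[OF n] B(3)[OF n]] by simp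
    fix x :: real
    have "(2::real) ^ 1 \<le> 2 ^ (B * n)"
      using B(1) n by (intro power_increasing) auto
    then have "2 * (real B * (1 + x\<^sup>2)) ^ (B * n) \<le> 2 ^ (B * n) * (real B * (1 + x\<^sup>2)) ^ (B * n)"
      by (intro mult_right_mono) auto
    also have "\<dots> = (real (2 * B) * (1 + x\<^sup>2)) ^ (B * n)"
      by (simp add: power_mult_distrib)
    also have "\<dots> \<le> (real (2 * B) * (1 + x\<^sup>2)) ^ (2 * B * n)"
    proof (rule power_increasing)
      have "1 * 1 \<le> real (2 * B) * (1 + x\<^sup>2)"
        using B(1) by (intro mult_mono) auto
      then show "1 \<le> real (2 * B) * (1 + x\<^sup>2)" by simp
    qed simp
    finally show "\<bar>poly (g n + h n) x\<bar> \<le> (real (2 * B) * (1 + x\<^sup>2)) ^ (2 * B * n)"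
      using B(4,5)[OF n, of x] by simp
  qed
qed

lemma exp_bounded_mult:
  assumes "exp_bounded g" "exp_bounded h"
  shows "exp_bounded (\<lambda>n. g n * h n)"
proof -
  obtain B where B: "B \<ge> 1" "\<And>n. n > 0 \<Longrightarrow> degree (g n) \<le> B * n" "\<And>n. n > 0 \<Longrightarrow> degree (h n) \<le> B * n"
    "\<And>n x. n > 0 \<Longrightarrow> \<bar>poly (g n) x\<bar> \<le> (real B * (1 + x\<^sup>2)) ^ (B * n)"
    "\<And>n x. n > 0 \<Longrightarrow> \<bar>poly (h n) x\<bar> \<le> (real B * (1 + x\<^sup>2)) ^ (B * n)"
    by (rule exp_boundedE2[OF assms]) blast
  show ?thesis
  proof (rule exp_boundedI[where B = "2 * B"])
    fix n :: nat assume n: "n > 0"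
    show "degree (g n * h n) \<le> 2 * B * n"
      using degree_mult_le[of "g n" "h n"] B(2,3)[OF n] by simp
    fix x :: real
    have "\<bar>poly (g n * h n) x\<bar> \<le> (real B * (1 + x\<^sup>2)) ^ (B * n) * (real B * (1 + x\<^sup>2)) ^ (B * n)"
      unfolding poly_mult abs_mult using B(4,5)[OF n, of x] by (intro mult_mono) auto
    also have "\<dots> = (real B * (1 + x\<^sup>2)) ^ (2 * B * n)"
      by (simp add: power_add[symmetric] mult_2 distrib_right)
    also have "\<dots> \<le> (real (2 * B) * (1 + x\<^sup>2)) ^ (2 * B * n)"
      by (intro power_mono mult_right_mono) auto
    finally show "\<bar>poly (g n * h n) x\<bar> \<le> (real (2 * B) * (1 + x\<^sup>2)) ^ (2 * B * n)" .
  qed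
qed

lemma exp_bounded_const: "exp_bounded (\<lambda>_. h)"
proof (induction h)
  case 0
  show ?case by (rule exp_boundedI[where B = 0]) auto
next
  case (pCons a h)
  have "exp_bounded (\<lambda>_. [:a:])"
  proof (rule exp_boundedI)
    fix n :: nat and x :: real assume n: "n > 0"
    define B where "B = nat \<lceil>\<bar>a\<bar>\<rceil> + 1"
    have B: "\<bar>a\<bar> \<le> real B" "1 \<le> B" unfolding B_def by linarith+
    have "real B * 1 \<le> real B * (1 + x\<^sup>2)"
      by (intro mult_left_mono) auto
    then have *: "real B \<le> real B * (1 + x\<^sup>2)" by simp
    moreover have "1 \<le> real B" using B(2) by simp
    ultimately have "1 \<le> real B * (1 + x\<^sup>2)" by linarith
    then have "real B * (1 + x\<^sup>2) \<le> (real B * (1 + x\<^sup>2)) ^ (B * n)"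
      using B n by (intro self_le_power) auto
    with * have "real B \<le> (real B * (1 + x\<^sup>2)) ^ (B * n)" by linarith
    then show "\<bar>poly [:a:] x\<bar> \<le> (real (nat \<lceil>\<bar>a\<bar>\<rceil> + 1) * (1 + x\<^sup>2)) ^ ((nat \<lceil>\<bar>a\<bar>\<rceil> + 1) * n)"
      using B unfolding B_def by simp
  qed simp
  moreover have "exp_bounded (\<lambda>_. [:0, 1:])"
  proof (rule exp_boundedI[where B = 1])
    fix n :: nat and x :: real assume n: "n > 0"
    have "0 \<le> (\<bar>x\<bar> - 1)\<^sup>2" by simp
    then have "\<bar>x\<bar> \<le> 1 + x\<^sup>2" by (simp add: power2_eq_square algebra_simps)
    also have "\<dots> \<le> (1 + x\<^sup>2) ^ n"
      using n by (intro self_le_power) auto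
    finally show "\<bar>poly [:0, 1:] x\<bar> \<le> (real 1 * (1 + x\<^sup>2)) ^ (1 * n)" by simp
  qed simp
  ultimately have "exp_bounded (\<lambda>n. [:a:] + [:0, 1:] * h)"
    using pCons.IH by (intro exp_bounded_add exp_bounded_mult)
  then show ?case by simp
qed

lemma exp_bounded_power:
  assumes "exp_bounded g"
  shows "exp_bounded (\<lambda>n. g n ^ k)"
  by (induction k) (use assms in \<open>auto intro: exp_bounded_const exp_bounded_mult\<close>)

lemma exp_bounded_sum:
  assumes "\<And>a. a \<in> A \<Longrightarrow> exp_bounded (g a)"
  shows "exp_bounded (\<lambda>n. \<Sum>a\<in>A. g a n)"
  using assms
  by (induction A rule: infinite_finite_induct) (auto intro: exp_bounded_const exp_bounded_add)

lemma exp_bounded_of_nat: "exp_bounded (\<lambda>n. [:real n:])"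
proof (rule exp_boundedI[where B = 2])
  fix n :: nat and x :: real
  have "real n \<le> 2 ^ n" by (rule less_imp_le) (rule of_nat_less_two_power)
  also have "\<dots> \<le> 2 ^ (2 * n)" by (intro power_increasing) auto
  also have "\<dots> \<le> (real 2 * (1 + x\<^sup>2)) ^ (2 * n)" by (intro power_mono) auto
  finally show "\<bar>poly [:real n:] x\<bar> \<le> (real 2 * (1 + x\<^sup>2)) ^ (2 * n)" by simp
qed simp

lemma exp_bounded_geometric: "exp_bounded (\<lambda>n. w ^ (L * n))"
proof -
  obtain B where B: "B \<ge> L" "\<And>n::nat. n > 0 \<Longrightarrow> degree w \<le> B * n"
    "\<And>n x. n > 0 \<Longrightarrow> \<bar>poly w x\<bar> \<le> (real B * (1 + x\<^sup>2)) ^ (B * n)" "B \<ge> 1"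
    using exp_boundedE[OF exp_bounded_const[of w]] by metis
  show ?thesis
  proof (rule exp_boundedI[where B = "B * B"])
    fix n :: nat
    have "degree (w ^ (L * n)) \<le> degree w * (L * n)"
      by (rule degree_power_le)
    also have "\<dots> \<le> B * (B * n)"
      using B(1) B(2)[of 1] by (intro mult_le_mono) auto
    finally show "degree (w ^ (L * n)) \<le> B * B * n" by (simp add: mult.assoc)
    fix x :: real
    have *: "1 * 1 \<le> real B * (1 + x\<^sup>2)" "1 * 1 \<le> real (B * B) * (1 + x\<^sup>2)"
      using B(4) le_square[of B] by (intro mult_mono; auto simp del: of_nat_mult)+
    have "\<bar>poly (w ^ (L * n)) x\<bar> = \<bar>poly w x\<bar> ^ (L * n)"
      by (simp add: power_abs)
    also have "\<dots> \<le> ((real B * (1 + x\<^sup>2)) ^ B) ^ (L * n)"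
      using B(3)[of 1 x] by (intro power_mono) auto
    also have "\<dots> = (real B * (1 + x\<^sup>2)) ^ (B * (L * n))"
      by (simp add: power_mult)
    also have "\<dots> \<le> (real B * (1 + x\<^sup>2)) ^ (B * (B * n))"
      using B(1) * by (intro power_increasing) auto
    also have "\<dots> \<le> (real (B * B) * (1 + x\<^sup>2)) ^ (B * (B * n))"
      using le_square[of B] by (intro power_mono mult_right_mono) (auto simp del: of_nat_mult)
    finally show "\<bar>poly (w ^ (L * n)) x\<bar> \<le> (real (B * B) * (1 + x\<^sup>2)) ^ (B * B * n)"
      by (simp add: mult.assoc)
  qed
qed

text \<open>
  The index \<open>n\<close> is the inverse square root of the accuracy: the order of the relaxation has to be
  proportional to it.
\<close>
definition module_family :: "nat \<Rightarrow> (nat \<Rightarrow> real poly) \<Rightarrow> (nat \<Rightarrow> real poly) \<Rightarrow> bool" where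
  "module_family np p g \<longleftrightarrow> (\<exists>D. \<forall>n>0. g n \<in> truncated_quadratic_module np p (D * n))"

lemma module_family_const:
  assumes "h \<in> truncated_quadratic_module np p r"
  shows "module_family np p (\<lambda>_. h)"
  unfolding module_family_def
  by (rule exI[of _ r]) (auto intro: truncated_quadratic_module_mono[OF assms])

lemma module_family_add:
  assumes "module_family np p g" "module_family np p h"
  shows "module_family np p (\<lambda>n. g n + h n)"
proof -
  obtain D E where *: "\<And>n. n > 0 \<Longrightarrow> g n \<in> truncated_quadratic_module np p (D * n)"
    "\<And>n. n > 0 \<Longrightarrow> h n \<in> truncated_quadratic_module np p (E * n)"
    using assms unfolding module_family_def by blast
  have "g n + h n \<in> truncated_quadratic_module np p ((D + E) * n)" if "n > 0" for n
    using *[OF that] by (intro truncated_quadratic_module_add) (auto elim!: truncated_quadratic_module_mono)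
  then show ?thesis unfolding module_family_def by blast
qed

lemma module_family_sum:
  assumes "\<And>a. a \<in> A \<Longrightarrow> module_family np p (g a)"
  shows "module_family np p (\<lambda>n. \<Sum>a\<in>A. g a n)"
proof -
  have "module_family np p (\<lambda>_. 0)"
    by (rule module_family_const[where r = 0])
      (auto intro: truncated_quadratic_module_sos simp: sos_polys_iff_nonneg)
  then show ?thesis
    using assms
    by (induction A rule: infinite_finite_induct) (auto intro: module_family_add)
qed

lemma module_family_nonneg_mult:
  assumes "exp_bounded w" "\<And>n x. 0 \<le> poly (w n) x" "module_family np p g"
  shows "module_family np p (\<lambda>n. w n * g n)"
proof -
  obtain D where D: "\<And>n. n > 0 \<Longrightarrow> g n \<in> truncated_quadratic_module np p (D * n)"
    using assms(3) unfolding module_family_def by blast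
  obtain B where B: "\<And>n. n > 0 \<Longrightarrow> degree (w n) \<le> B * n"
    using assms(1) unfolding exp_bounded_def by blast
  have "w n * g n \<in> truncated_quadratic_module np p ((B + D) * n)" if "n > 0" for n
    unfolding distrib_right using B[OF that] assms(2)
    by (intro truncated_quadratic_module_sos_mult D[OF that]) (auto simp: sos_polys_iff_nonneg)
  then show ?thesis unfolding module_family_def by blast
qed

section \<open>Localizing factors\<close>

lemma quarter_power_le_inverse_square:
  assumes "n > 0"
  shows "(1 / 4) ^ n \<le> 1 / (real n)\<^sup>2"
proof -
  have "(real n)\<^sup>2 \<le> (2 ^ n)\<^sup>2"
    by (rule power_mono[OF less_imp_le[OF of_nat_less_two_power]]) simp
  also have "\<dots> = 4 ^ n"
    by (simp add: power_mult[symmetric] mult.commute[of n] power_mult)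
  finally show ?thesis
    using assms by (simp add: power_one_over frac_le)
qed

text \<open>
  Even powers of the quadratic \<open>1 - (x - b\<^sub>1)(x - b\<^sub>2)/S\<close>, which is at least \<open>1\<close> exactly on
  \<open>[b\<^sub>1, b\<^sub>2]\<close> and, for large \<open>S\<close>, lies in \<open>[0, 1]\<close> on the rest of \<open>[-R, R]\<close>; at distance \<open>\<eta>\<close> from the
  interval it is bounded away from \<open>1\<close>, so an exponent that is a large multiple of \<open>n\<close> beats the
  exponential growth of \<open>g\<close>. A family that multiplies \<open>g\<close> by \<open>\<omega>\<close> thus acts only near \<open>[b\<^sub>1, b\<^sub>2]\<close>. That
  \<open>\<omega> \<le> 1\<close> holds right up to the end points is what protects the side of a sign change on which \<open>f\<close> is positive.
\<close>
lemma localizing_family: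
  fixes b1 b2 \<eta> R :: real
  assumes g: "exp_bounded g" and b: "b1 \<le> b2" and \<eta>: "\<eta> > 0"
  obtains \<omega> where "exp_bounded \<omega>" "\<And>n x. 0 \<le> poly (\<omega> n) x"
    "\<And>n x. x \<in> {b1..b2} \<Longrightarrow> 1 \<le> poly (\<omega> n) x"
    "\<And>n x. \<bar>x\<bar> \<le> R \<Longrightarrow> x \<notin> {b1..b2} \<Longrightarrow> poly (\<omega> n) x \<le> 1"
    "\<And>n x. n > 0 \<Longrightarrow> \<bar>x\<bar> \<le> R \<Longrightarrow> x \<notin> {b1 - \<eta><..<b2 + \<eta>} \<Longrightarrow>
       poly (\<omega> n) x * \<bar>poly (g n) x\<bar> \<le> 1 / (real n)\<^sup>2"
proof -
  \<comment> \<open>An upper bound of \<open>(x - b\<^sub>1)(x - b\<^sub>2)\<close> on \<open>[-R, R]\<close>.\<close>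
  define S where "S = (\<bar>R\<bar> + \<bar>b1\<bar>) * (\<bar>R\<bar> + \<bar>b2\<bar>) + 1"
  have S: "S > 0" unfolding S_def by (intro add_nonneg_pos mult_nonneg_nonneg) auto
  define v where "v = [:1 - b1 * b2 / S, (b1 + b2) / S, - (1 / S):]"
  have v: "poly v x = 1 - (x - b1) * (x - b2) / S" for x
    using S by (simp add: v_def field_simps)
  have v_in: "1 \<le> poly v x" if "x \<in> {b1..b2}" for x
    using that S by (simp add: v divide_nonpos_pos mult_nonneg_nonpos)
  have v_out: "0 \<le> poly v x \<and> poly v x \<le> 1" if "\<bar>x\<bar> \<le> R" "x \<notin> {b1..b2}" for x
  proof -
    have "0 \<le> (x - b1) * (x - b2)"
      using that(2) b by (auto simp: zero_le_mult_iff)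
    moreover have "\<bar>x - b1\<bar> * \<bar>x - b2\<bar> \<le> (\<bar>R\<bar> + \<bar>b1\<bar>) * (\<bar>R\<bar> + \<bar>b2\<bar>)"
      using that(1) by (intro mult_mono) auto
    ultimately have "(x - b1) * (x - b2) \<le> S" "0 \<le> (x - b1) * (x - b2)"
      by (auto simp: S_def abs_mult[symmetric])
    then show ?thesis using S by (simp add: v)
  qed
  \<comment> \<open>The value \<open>1 - \<eta>\<^sup>2 / S\<close> is negative only if no point of \<open>[-R, R]\<close> is that far away.\<close>
  define \<rho> where "\<rho> = max 0 (1 - \<eta>\<^sup>2 / S)"
  have \<rho>: "0 \<le> \<rho>" "\<rho> < 1" using S \<eta> by (auto simp: \<rho>_def)
  have v_far: "poly v x \<le> \<rho>" if "x \<notin> {b1 - \<eta><..<b2 + \<eta>}" for x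
  proof -
    have "x - b1 \<ge> \<eta> \<and> x - b2 \<ge> \<eta> \<or> b1 - x \<ge> \<eta> \<and> b2 - x \<ge> \<eta>"
      using that b by auto
    then have "\<eta> * \<eta> \<le> (x - b1) * (x - b2)"
    proof
      assume "b1 - x \<ge> \<eta> \<and> b2 - x \<ge> \<eta>"
      then have "\<eta> * \<eta> \<le> (b1 - x) * (b2 - x)"
        using \<eta> by (intro mult_mono) auto
      then show ?thesis by (simp add: algebra_simps)
    qed (use \<eta> in \<open>auto intro: mult_mono\<close>)
    then have "\<eta>\<^sup>2 / S \<le> (x - b1) * (x - b2) / S"
      using S by (intro divide_right_mono) (auto simp: power2_eq_square)
    then show ?thesis unfolding v \<rho>_def by linarith
  qed
  obtain B where B: "B \<ge> 1"
    "\<And>n x. n > 0 \<Longrightarrow> \<bar>poly (g n) x\<bar> \<le> (real B * (1 + x\<^sup>2)) ^ (B * n)"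
    using exp_boundedE[OF g] by metis
  define K where "K = (real B * (1 + R\<^sup>2)) ^ B"
  have "K > 0" using B(1) by (auto simp: K_def add_pos_nonneg)
  \<comment> \<open>The exponent \<open>2 L n\<close> turns the bound \<open>K\<^sup>n\<close> for \<open>g\<close> into \<open>4\<^sup>-\<^sup>n\<close>.\<close>
  then obtain L where L: "\<rho> ^ L < 1 / (4 * K)"
    using real_arch_pow_inv[of "1 / (4 * K)" \<rho>] \<rho> by auto
  show thesis
  proof
    show "exp_bounded (\<lambda>n. v ^ (2 * L * n))"
      by (rule exp_bounded_geometric)
    show "0 \<le> poly (v ^ (2 * L * n)) x" for n x
      by (simp add: power_mult mult.assoc)
    show "1 \<le> poly (v ^ (2 * L * n)) x" if "x \<in> {b1..b2}" for n x
      using v_in[OF that] by (simp add: one_le_power)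
    show "poly (v ^ (2 * L * n)) x \<le> 1" if "\<bar>x\<bar> \<le> R" "x \<notin> {b1..b2}" for n x
      using v_out[OF that] by (simp add: power_le_one)
    show "poly (v ^ (2 * L * n)) x * \<bar>poly (g n) x\<bar> \<le> 1 / (real n)\<^sup>2"
      if n: "n > 0" and x: "\<bar>x\<bar> \<le> R" "x \<notin> {b1 - \<eta><..<b2 + \<eta>}" for n x
    proof -
      have "x \<notin> {b1..b2}" using x(2) \<eta> by auto
      then have "0 \<le> poly v x" using v_out x(1) by blast
      then have "(poly v x) ^ (2 * L) \<le> \<rho> ^ (2 * L)"
        using v_far[OF x(2)] by (intro power_mono)
      also have "\<dots> \<le> \<rho> ^ L"
        using \<rho> by (intro power_decreasing) auto
      finally have vL: "(poly v x) ^ (2 * L) \<le> 1 / (4 * K)" using L by linarith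
      have "x\<^sup>2 \<le> R\<^sup>2" using x(1) by (simp add: abs_le_square_iff[symmetric])
      then have "(real B * (1 + x\<^sup>2)) ^ (B * n) \<le> (real B * (1 + R\<^sup>2)) ^ (B * n)"
        by (intro power_mono mult_left_mono) auto
      then have gK: "\<bar>poly (g n) x\<bar> \<le> K ^ n"
        using B(2)[OF n, of x] by (simp add: K_def power_mult)
      have "poly (v ^ (2 * L * n)) x * \<bar>poly (g n) x\<bar> = ((poly v x) ^ (2 * L)) ^ n * \<bar>poly (g n) x\<bar>"
        by (simp add: power_mult)
      also have "\<dots> \<le> (1 / (4 * K)) ^ n * K ^ n"
        using vL gK \<open>K > 0\<close> by (intro mult_mono power_mono) (auto simp: power_mult)
      also have "\<dots> = (1 / 4) ^ n"
        using \<open>K > 0\<close> by (simp add: power_mult_distrib[symmetric])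
      finally show ?thesis
        using quarter_power_le_inverse_square[OF n] by linarith
    qed
  qed
qed

section \<open>Fejer polynomials\<close>

text \<open>
  The Fejer kernel as a polynomial in \<open>z = 1 - cos t\<close>: the quotient \<open>(1 - T\<^sub>n(1 - z)) / z\<close> for the
  Chebyshev polynomial \<open>T\<^sub>n\<close>, by way of the three-term recursion. It stays below \<open>2 / z\<close> on \<open>(0, 2]\<close> and
  jumps to at least \<open>n\<^sup>2\<close> at \<open>z = 0\<close> and to the left of it. An ideal multiplier would behave like a
  power of \<open>1 / z\<close> up to the distance \<open>\<epsilon>\<close> from the boundary point \<open>z = 0\<close>; that a polynomial of degree \<open>n\<close> does so
  for \<open>\<epsilon> = 1 / n\<^sup>2\<close> is the source of the quadratic rate.
\<close>
fun fejer_poly :: "nat \<Rightarrow> real poly" where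
  "fejer_poly 0 = 0"
| "fejer_poly (Suc 0) = 1"
| "fejer_poly (Suc (Suc n)) = [:2:] + [:2, - 2:] * fejer_poly (Suc n) - fejer_poly n"

lemma degree_fejer_poly: "degree (fejer_poly n) \<le> n"
proof (induction n rule: fejer_poly.induct)
  case (3 n)
  have "degree ([:2, - 2:] * fejer_poly (Suc n)) \<le> Suc (Suc n)"
    using degree_mult_le[of "[:2, - 2:]" "fejer_poly (Suc n)"] 3(1) by simp
  then have "degree ([:2:] + [:2, - 2:] * fejer_poly (Suc n)) \<le> Suc (Suc n)"
    by (intro degree_add_le) auto
  then show ?case
    unfolding fejer_poly.simps using 3(2) by (intro degree_diff_le) auto
qed auto

lemma fejer_poly_cos:
  "(1 - cos t) * poly (fejer_poly n) (1 - cos t) = 1 - cos (real n * t)"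
proof (induction n rule: fejer_poly.induct)
  case (3 n)
  have "cos (real (Suc n) * t + t) + cos (real (Suc n) * t - t) = 2 * cos t * cos (real (Suc n) * t)"
    unfolding cos_add cos_diff by simp
  then have c: "cos (real (Suc (Suc n)) * t) = 2 * cos t * cos (real (Suc n) * t) - cos (real n * t)"
    by (simp add: algebra_simps)
  have "(1 - cos t) * poly (fejer_poly (Suc (Suc n))) (1 - cos t) =
      2 * (1 - cos t) + 2 * cos t * ((1 - cos t) * poly (fejer_poly (Suc n)) (1 - cos t))
      - (1 - cos t) * poly (fejer_poly n) (1 - cos t)"
    by (simp add: algebra_simps)
  also have "\<dots> = 1 - cos (real (Suc (Suc n)) * t)"
    unfolding 3 c by (simp add: algebra_simps)
  finally show ?case .
qed auto

text \<open>
  Substitute \<open>z = 1 - cos t\<close>: then \<open>z\<close> times the polynomial is \<open>1 - cos (n t)\<close>.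
\<close>
lemma fejer_poly_bounds_right:
  assumes "0 < z" "z \<le> 2"
  shows "0 \<le> poly (fejer_poly n) z" and "poly (fejer_poly n) z \<le> 2 / z"
proof -
  have z: "1 - cos (arccos (1 - z)) = z"
    using assms by simp
  have *: "z * poly (fejer_poly n) z = 1 - cos (real n * arccos (1 - z))"
    using fejer_poly_cos[of "arccos (1 - z)" n] unfolding z .
  have "0 \<le> z * poly (fejer_poly n) z"
    unfolding * by (simp add: cos_le_one)
  then show "0 \<le> poly (fejer_poly n) z"
    using assms by (simp add: zero_le_mult_iff)
  have "z * poly (fejer_poly n) z \<le> 2"
    unfolding * using cos_ge_minus_one[of "real n * arccos (1 - z)"] by linarith
  then show "poly (fejer_poly n) z \<le> 2 / z"
    using assms by (simp add: field_simps)
qed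

text \<open>
  For \<open>z \<le> 0\<close> the recursion makes the increments of \<open>n \<mapsto> fejer_poly n\<close> grow by at least \<open>2\<close> in every
  step, so they dominate the odd numbers, whose sum is \<open>n\<^sup>2\<close>.
\<close>
lemma fejer_poly_bound_left:
  assumes "z \<le> 0"
  shows "(real n)\<^sup>2 \<le> poly (fejer_poly n) z"
proof -
  have "(real n)\<^sup>2 \<le> poly (fejer_poly n) z \<and>
      2 * real n + 1 \<le> poly (fejer_poly (Suc n)) z - poly (fejer_poly n) z"
  proof (induction n)
    case (Suc n)
    have sq: "(real (Suc n))\<^sup>2 = (real n)\<^sup>2 + (2 * real n + 1)"
      by (simp add: power2_eq_square algebra_simps)
    have 1: "(real (Suc n))\<^sup>2 \<le> poly (fejer_poly (Suc n)) z"
      using Suc unfolding sq by linarith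
    then have "0 \<le> poly (fejer_poly (Suc n)) z"
      using zero_le_power2[of "real (Suc n)"] by linarith
    then have "0 \<le> - z * poly (fejer_poly (Suc n)) z"
      using assms by (intro mult_nonneg_nonneg) auto
    then have "2 * real (Suc n) + 1 \<le> poly (fejer_poly (Suc (Suc n))) z - poly (fejer_poly (Suc n)) z"
      using Suc by (simp add: algebra_simps)
    with 1 show ?case by blast
  qed simp
  then show ?thesis by blast
qed

lemma fejer_poly_growth: "\<bar>poly (fejer_poly n) z\<bar> \<le> (5 + 2 * \<bar>z\<bar>) ^ n"
proof (induction n rule: fejer_poly.induct)
  case (3 n)
  define b where "b = 5 + 2 * \<bar>z\<bar>"
  have "1 \<le> b ^ n" "b \<ge> 5" unfolding b_def by (auto intro: one_le_power)
  have "\<bar>poly (fejer_poly (Suc (Suc n))) z\<bar> \<le>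
      2 + \<bar>2 - 2 * z\<bar> * \<bar>poly (fejer_poly (Suc n)) z\<bar> + \<bar>poly (fejer_poly n) z\<bar>"
    by (simp add: abs_mult[symmetric] algebra_simps)
  also have "\<dots> \<le> 2 + (b - 3) * b ^ Suc n + b ^ n"
    using 3 unfolding b_def by (intro add_mono mult_mono) auto
  also have "\<dots> \<le> 2 * b ^ n + (b - 3) * b ^ Suc n + b ^ n"
    using \<open>1 \<le> b ^ n\<close> by simp
  also have "\<dots> = (3 + (b - 3) * b) * b ^ n"
    by (simp add: algebra_simps)
  also have "\<dots> \<le> (b * b) * b ^ n"
    using \<open>b \<ge> 5\<close> by (intro mult_right_mono) (auto simp: algebra_simps)
  finally show ?case by (simp add: b_def)
qed auto

text \<open>
  The affine argument is the local coordinate \<open>s (x - a)\<close> at \<open>a\<close> that points in the direction \<open>s\<close>.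
\<close>
lemma exp_bounded_fejer_poly:
  fixes a s :: real
  assumes "\<bar>s\<bar> = 1"
  shows "exp_bounded (\<lambda>n. pcompose (fejer_poly n) [:- s * a, s:])"
proof (rule exp_boundedI)
  define B where "B = nat \<lceil>7 + 2 * \<bar>a\<bar>\<rceil>"
  have B: "7 + 2 * \<bar>a\<bar> \<le> real B" unfolding B_def by linarith
  then have B1: "B \<ge> 1" using abs_ge_zero[of a] by (cases B) auto
  fix n :: nat
  have "degree (pcompose (fejer_poly n) [:- s * a, s:]) \<le> n * 1"
    by (rule order_trans[OF degree_pcompose_le mult_le_mono[OF degree_fejer_poly]]) simp
  also have "\<dots> \<le> B * n" using B1 by simp
  finally show "degree (pcompose (fejer_poly n) [:- s * a, s:]) \<le> B * n" .
  fix x :: real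
  have "\<bar>s * (x - a)\<bar> = \<bar>x - a\<bar>" by (simp add: abs_mult assms)
  also have "\<dots> \<le> \<bar>x\<bar> + \<bar>a\<bar>" by simp
  finally have s: "\<bar>s * (x - a)\<bar> \<le> \<bar>x\<bar> + \<bar>a\<bar>" .
  have "0 \<le> (\<bar>x\<bar> - 1)\<^sup>2" by simp
  then have x: "2 * \<bar>x\<bar> \<le> 1 + x\<^sup>2" by (simp add: power2_eq_square algebra_simps)
  have "5 + 2 * \<bar>s * (x - a)\<bar> \<le> 5 + 2 * (\<bar>x\<bar> + \<bar>a\<bar>)"
    using s by simp
  also have "\<dots> \<le> (7 + 2 * \<bar>a\<bar>) + 7 * x\<^sup>2"
    using x zero_le_power2[of x] by argo
  also have "\<dots> \<le> real B + real B * x\<^sup>2"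
    using B abs_ge_zero[of a] by (intro add_mono mult_right_mono; linarith?) auto
  finally have *: "5 + 2 * \<bar>s * (x - a)\<bar> \<le> real B * (1 + x\<^sup>2)" by (simp add: distrib_left)
  have "\<bar>poly (fejer_poly n) (s * (x - a))\<bar> \<le> (5 + 2 * \<bar>s * (x - a)\<bar>) ^ n"
    by (rule fejer_poly_growth)
  also have "\<dots> \<le> (real B * (1 + x\<^sup>2)) ^ n"
    using * by (intro power_mono) auto
  also have "\<dots> \<le> (real B * (1 + x\<^sup>2)) ^ (B * n)"
    using * B1 by (intro power_increasing) auto
  finally show "\<bar>poly (pcompose (fejer_poly n) [:- s * a, s:]) x\<bar> \<le> (real B * (1 + x\<^sup>2)) ^ (B * n)"
    by (simp add: poly_pcompose algebra_simps)
qed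

section \<open>Corrections near one point\<close>

text \<open>
  A family in the quadratic module that, near \<open>a\<close> and up to \<open>O(1 / n\<^sup>2)\<close>, lies below \<open>f\<close> wherever \<open>f\<close> is
  negative, and that does no harm elsewhere in \<open>[-R, R]\<close>: it may use up only the fraction \<open>\<theta>\<close> of the
  positive part of \<open>f\<close>. Since \<open>V\<close> is chosen before \<open>\<theta>\<close>, one can first extract a finite subcover of
  \<open>[-R, R]\<close> and then divide \<open>f\<close> among its members.
\<close>
definition local_certificate :: "nat \<Rightarrow> (nat \<Rightarrow> real poly) \<Rightarrow> real poly \<Rightarrow> real \<Rightarrow> real \<Rightarrow> bool" where
  "local_certificate np p f R a \<longleftrightarrow>
     (\<exists>V. open V \<and> a \<in> V \<and>
       (\<forall>\<theta>>0. \<exists>g C. exp_bounded g \<and> module_family np p g \<and>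
         (\<forall>n>0. \<forall>x. \<bar>x\<bar> \<le> R \<longrightarrow>
            poly (g n) x \<le> \<theta> * max 0 (poly f x) + C / (real n)\<^sup>2 \<and>
            (x \<in> V \<and> poly f x < 0 \<longrightarrow> poly (g n) x \<le> poly f x + C / (real n)\<^sup>2))))"

lemma poly_bounded_on_interval:
  fixes q :: "real poly"
  obtains M where "M > 0" "\<And>x. \<bar>x\<bar> \<le> R \<Longrightarrow> \<bar>poly q x\<bar> \<le> M"
proof -
  have "compact (poly q ` {-R..R})"
    by (intro compact_continuous_image continuous_on_poly continuous_on_id) simp
  then obtain M where M: "M > 0" "\<forall>y \<in> poly q ` {-R..R}. norm y \<le> M"
    using compact_imp_bounded bounded_pos by metis
  show thesis
  proof (rule that[OF M(1)])
    fix x assume "\<bar>x\<bar> \<le> R"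
    then have "x \<in> {-R..R}" by auto
    then show "\<bar>poly q x\<bar> \<le> M" using M(2) by auto
  qed
qed

lemma poly_local_bounds:
  fixes w :: "real poly"
  assumes "poly w a > 0"
  obtains \<delta> where "\<delta> > 0" "\<And>x. \<bar>x - a\<bar> \<le> \<delta> \<Longrightarrow> poly w a / 2 \<le> poly w x \<and> poly w x \<le> 2 * poly w a"
proof -
  have "isCont (poly w) a" by (rule poly_isCont)
  then obtain d where d: "d > 0" "\<And>x. \<bar>x - a\<bar> < d \<Longrightarrow> \<bar>poly w x - poly w a\<bar> < poly w a / 2"
    using assms unfolding continuous_at_eps_delta dist_real_def by (metis half_gt_zero)
  show thesis
  proof (rule that[of "d / 2"])
    fix x assume "\<bar>x - a\<bar> \<le> d / 2"
    then have "\<bar>x - a\<bar> < d" using d(1) by linarith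
    from d(2)[OF this] show "poly w a / 2 \<le> poly w x \<and> poly w x \<le> 2 * poly w a"
      using assms by linarith
  qed (use d in auto)
qed

lemma local_certificate_trivial:
  assumes "open V" "a \<in> V" "\<And>x. x \<in> V \<Longrightarrow> 0 \<le> poly f x"
  shows "local_certificate np p f R a"
proof -
  have "exp_bounded (\<lambda>_. 0)" "module_family np p (\<lambda>_. 0)"
    using exp_bounded_const module_family_sum[of "{}"] by auto
  then show ?thesis
    unfolding local_certificate_def using assms
    by (intro exI[of _ V] conjI allI impI exI[of _ "\<lambda>_. 0"] exI[of _ 0]) (auto simp: not_less)
qed

text \<open>
  An element \<open>h\<close> of the module that is negative on both sides of \<open>a\<close> is harmless on the whole
  neighbourhood, so it may be multiplied by a huge constant. At distance at least \<open>1 / n\<^sup>2\<close> from \<open>a\<close>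
  the constant \<open>n\<^sup>2\<^sup>e F / c\<close> pushes it below every value of \<open>f\<close> on \<open>[-R, R]\<close>; nearer to \<open>a\<close>, the Lipschitz bound for
  \<open>f\<close> already gives \<open>f \<ge> - M / n\<^sup>2\<close>, for which \<open>f(a) \<ge> 0\<close> is used. For \<open>e = 0\<close>, the case of an
  infeasible point, the second argument does not arise.
\<close>
lemma local_certificate_negative_element:
  assumes h: "h \<in> truncated_quadratic_module np p r"
    and c: "c > 0" and \<delta>: "\<delta> > 0"
    and neg: "\<And>x. \<bar>x - a\<bar> \<le> \<delta> \<Longrightarrow> poly h x \<le> - c * \<bar>x - a\<bar> ^ e"
    and fa: "e = 0 \<or> 0 \<le> poly f a"
  shows "local_certificate np p f R a"
proof -
  obtain F where F: "F > 0" "\<And>x. \<bar>x\<bar> \<le> R \<Longrightarrow> \<bar>poly f x\<bar> \<le> F"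
    using poly_bounded_on_interval by blast
  have "poly (f - [:poly f a:]) a = 0" by simp
  then obtain q where q: "f - [:poly f a:] = [:-a, 1:] * q"
    unfolding poly_eq_0_iff_dvd by (elim dvdE)
  obtain M where M: "M > 0" "\<And>x. \<bar>x\<bar> \<le> R \<Longrightarrow> \<bar>poly q x\<bar> \<le> M"
    using poly_bounded_on_interval by blast
  have f_lower: "- (M * \<bar>x - a\<bar>) \<le> poly f x" if "\<bar>x\<bar> \<le> R" "0 \<le> poly f a" for x
  proof -
    have "poly f x = poly f a + (x - a) * poly q x"
      using arg_cong[OF q, of "\<lambda>q. poly q x"] by (simp add: algebra_simps)
    moreover have "\<bar>(x - a) * poly q x\<bar> \<le> \<bar>x - a\<bar> * M"
      unfolding abs_mult by (intro mult_left_mono M(2) that) auto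
    ultimately show ?thesis using that(2) by (simp add: mult.commute abs_le_iff)
  qed
  define g0 where "g0 = (\<lambda>n. [:F / c:] * [:real n:] ^ (2 * e) * h)"
  have poly_g0: "poly (g0 n) x = F / c * (real n ^ (2 * e) * poly h x)" for n x
    by (simp add: g0_def poly_power)
  have g0_exp: "exp_bounded g0"
    unfolding g0_def
    by (intro exp_bounded_mult exp_bounded_const exp_bounded_power exp_bounded_of_nat)
  have g0_mod: "module_family np p g0"
    unfolding g0_def
    by (intro module_family_nonneg_mult exp_bounded_mult exp_bounded_const exp_bounded_power
        exp_bounded_of_nat module_family_const[OF h]) (use F(1) c in \<open>auto simp: poly_power\<close>)
  have J: "a - \<delta> / 2 \<le> a + \<delta> / 2" "0 < \<delta> / 2" using \<delta> by auto
  obtain \<omega> where \<omega>: "exp_bounded \<omega>" "\<And>n x. 0 \<le> poly (\<omega> n) x"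
    "\<And>n x. x \<in> {a - \<delta> / 2..a + \<delta> / 2} \<Longrightarrow> 1 \<le> poly (\<omega> n) x"
    "\<And>n x. n > 0 \<Longrightarrow> \<bar>x\<bar> \<le> R \<Longrightarrow> x \<notin> {a - \<delta> / 2 - \<delta> / 2<..<a + \<delta> / 2 + \<delta> / 2} \<Longrightarrow>
       poly (\<omega> n) x * \<bar>poly (g0 n) x\<bar> \<le> 1 / (real n)\<^sup>2"
    by (rule localizing_family[OF g0_exp J]) blast
  define g where "g = (\<lambda>n. \<omega> n * g0 n)"
  have poly_g: "poly (g n) x = poly (\<omega> n) x * poly (g0 n) x" for n x
    by (simp add: g_def)
  have g0_neg: "poly (g0 n) x \<le> - F * (real n ^ (2 * e) * \<bar>x - a\<bar> ^ e)" if "\<bar>x - a\<bar> \<le> \<delta>" for n x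
  proof -
    have "F / c * (real n ^ (2 * e) * poly h x) \<le> F / c * (real n ^ (2 * e) * (- c * \<bar>x - a\<bar> ^ e))"
      using F(1) c by (intro mult_left_mono neg that) auto
    also have "\<dots> = - F * (real n ^ (2 * e) * \<bar>x - a\<bar> ^ e)"
      using c by simp
    finally show ?thesis unfolding poly_g0 .
  qed
  have g0_nonpos: "poly (g0 n) x \<le> 0" if "\<bar>x - a\<bar> \<le> \<delta>" for n x
  proof -
    have "0 \<le> F * (real n ^ (2 * e) * \<bar>x - a\<bar> ^ e)"
      using F(1) by (intro mult_nonneg_nonneg) auto
    with g0_neg[OF that, of n] show ?thesis by linarith
  qed
  have g_nonpos: "poly (g n) x \<le> 0" if "\<bar>x - a\<bar> \<le> \<delta>" for n x
    unfolding poly_g using \<omega>(2) g0_nonpos[OF that] by (rule mult_nonneg_nonpos)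
  have upper: "poly (g n) x \<le> 1 / (real n)\<^sup>2" if "n > 0" "\<bar>x\<bar> \<le> R" for n x
  proof (cases "\<bar>x - a\<bar> < \<delta>")
    case True
    have "poly (g n) x \<le> 0" using True by (intro g_nonpos) simp
    also have "0 \<le> 1 / (real n)\<^sup>2" by simp
    finally show ?thesis .
  next
    case False
    then have "x \<notin> {a - \<delta> / 2 - \<delta> / 2<..<a + \<delta> / 2 + \<delta> / 2}" by auto
    have "poly (g n) x \<le> poly (\<omega> n) x * \<bar>poly (g0 n) x\<bar>"
      unfolding poly_g using \<omega>(2) by (intro mult_left_mono) auto
    also have "\<dots> \<le> 1 / (real n)\<^sup>2"
      by (rule \<omega>(4)) fact+
    finally show ?thesis .
  qed
  have near: "poly (g n) x \<le> poly f x + (M + 1) / (real n)\<^sup>2"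
    if n: "n > 0" and x: "\<bar>x\<bar> \<le> R" "\<bar>x - a\<bar> < \<delta> / 2" for n x
  proof (cases "e \<noteq> 0 \<and> \<bar>x - a\<bar> < 1 / (real n)\<^sup>2")
    case True
    then have "M * \<bar>x - a\<bar> \<le> M * (1 / (real n)\<^sup>2)"
      using M(1) by (intro mult_left_mono) auto
    also have "\<dots> \<le> (M + 1) / (real n)\<^sup>2"
      by (simp add: divide_right_mono)
    finally have "0 \<le> poly f x + (M + 1) / (real n)\<^sup>2"
      using f_lower[OF x(1)] fa True by auto
    moreover have "poly (g n) x \<le> 0" using x(2) \<delta> by (intro g_nonpos) simp
    ultimately show ?thesis by linarith
  next
    case False
    have "1 \<le> ((real n)\<^sup>2 * \<bar>x - a\<bar>) ^ e"
    proof (cases "e = 0")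
      case False
      then have "1 \<le> (real n)\<^sup>2 * \<bar>x - a\<bar>"
        using \<open>\<not> (e \<noteq> 0 \<and> \<bar>x - a\<bar> < 1 / (real n)\<^sup>2)\<close> n by (simp add: field_simps)
      then show ?thesis by (rule one_le_power)
    qed simp
    then have "F * 1 \<le> F * (real n ^ (2 * e) * \<bar>x - a\<bar> ^ e)"
      using F(1) by (intro mult_left_mono) (auto simp: power_mult_distrib power_mult)
    then have 1: "poly (g0 n) x \<le> - F"
      using g0_neg[of x n] x(2) \<delta> by linarith
    have "x \<in> {a - \<delta> / 2..a + \<delta> / 2}"
      using x(2)[unfolded abs_less_iff] unfolding atLeastAtMost_iff by linarith
    then have "1 \<le> poly (\<omega> n) x" by (rule \<omega>(3))
    then have "poly (g n) x \<le> 1 * poly (g0 n) x"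
      unfolding poly_g using 1 F(1) by (intro mult_right_mono_neg) auto
    also have "\<dots> \<le> poly f x + 0"
      using 1 F(2)[OF x(1)] by auto
    also have "\<dots> \<le> poly f x + (M + 1) / (real n)\<^sup>2"
      using M(1) by (intro add_left_mono) auto
    finally show ?thesis .
  qed
  have "exp_bounded g" "module_family np p g"
    unfolding g_def using \<omega>(1,2) g0_exp g0_mod
    by (auto intro: exp_bounded_mult module_family_nonneg_mult)
  moreover have "poly (g n) x \<le> \<theta> * max 0 (poly f x) + (M + 1) / (real n)\<^sup>2"
    if "n > 0" "\<bar>x\<bar> \<le> R" "\<theta> > 0" for n x and \<theta> :: real
  proof -
    have "1 / (real n)\<^sup>2 \<le> (M + 1) / (real n)\<^sup>2"
      using M(1) by (intro divide_right_mono) auto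
    moreover have "0 \<le> \<theta> * max 0 (poly f x)" using that(3) by simp
    ultimately show ?thesis using upper[OF that(1,2)] by linarith
  qed
  moreover have "open {a - \<delta> / 2<..<a + \<delta> / 2}" "a \<in> {a - \<delta> / 2<..<a + \<delta> / 2}"
    using \<delta> by auto
  moreover have "\<bar>x - a\<bar> < \<delta> / 2" if "x \<in> {a - \<delta> / 2<..<a + \<delta> / 2}" for x
    using that unfolding abs_less_iff greaterThanLessThan_iff by linarith
  ultimately show ?thesis
    unfolding local_certificate_def using near by meson
qed

lemma local_certificate_even_order:
  assumes h: "[:-a, 1:] ^ e * v \<in> truncated_quadratic_module np p r"
    and "even e" and v: "poly v a < 0" and fa: "e = 0 \<or> 0 \<le> poly f a"
  shows "local_certificate np p f R a"
proof -
  obtain \<delta> where \<delta>: "\<delta> > 0"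
    "\<And>x. \<bar>x - a\<bar> \<le> \<delta> \<Longrightarrow> poly (- v) a / 2 \<le> poly (- v) x \<and> poly (- v) x \<le> 2 * poly (- v) a"
    by (rule poly_local_bounds[of "- v" a]) (use v in auto)
  show ?thesis
  proof (rule local_certificate_negative_element[OF h _ \<delta>(1) _ fa])
    show "0 < - poly v a / 2" using v by simp
    fix x assume "\<bar>x - a\<bar> \<le> \<delta>"
    then have "poly v x \<le> - (- poly v a / 2)"
      using \<delta>(2)[of x] by simp
    then have "(x - a) ^ e * poly v x \<le> (x - a) ^ e * - (- poly v a / 2)"
      using \<open>even e\<close> by (intro mult_left_mono) (auto simp: zero_le_even_power)
    also have "(x - a) ^ e = \<bar>x - a\<bar> ^ e"
      using \<open>even e\<close> by (simp add: power_even_abs)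
    finally show "poly ([:-a, 1:] ^ e * v) x \<le> - (- poly v a / 2) * \<bar>x - a\<bar> ^ e"
      using \<open>even e\<close> by (simp add: poly_power power_even_abs mult.commute)
  qed
qed

text \<open>
  The decisive case: \<open>f\<close> and \<open>h\<close> change sign at \<open>a\<close> in the same direction, and in the coordinate
  \<open>z = s (x - a)\<close>, which points to the positive side, \<open>f \<approx> z\<^sup>m\<close> and \<open>h \<approx> z\<^sup>k\<close> with odd \<open>m < k\<close>. The correction
  should be close to \<open>f / h \<approx> z\<^sup>m\<^sup>-\<^sup>k\<close> times \<open>h\<close>: at most that for \<open>z > 0\<close>, at least that for
  \<open>z < - A / n\<^sup>2\<close>. The power \<open>k - m\<close> of the Fejer polynomial in \<open>z\<close> does both, and it is a square since
  \<open>k - m\<close> is even. The gap between \<open>2 / z\<close> and \<open>n\<^sup>2\<close> leaves room for the constants: \<open>\<alpha>\<close> is made small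
  enough for the positive side, and then \<open>A\<close> large enough for the negative side. The localizing
  family is built on an interval on the negative side that ends at \<open>a\<close>, so that it does not exceed
  \<open>1\<close> on the positive side.
\<close>
lemma local_certificate_higher_odd_order:
  assumes h_def: "h = [:-a, 1:] ^ k * v" and h: "h \<in> truncated_quadratic_module np p r"
    and f_def: "f = [:-a, 1:] ^ m * u" and "odd k" "odd m" "m < k"
    and s: "\<bar>s\<bar> = 1" and v: "s * poly v a > 0" and u: "s * poly u a > 0"
  shows "local_certificate np p f R a"
proof -
  have s_cases: "s = 1 \<or> s = -1" using s by linarith
  have s_power: "s ^ j = s" if "odd j" for j
    using s_cases that by auto
  define v0 where "v0 = s * poly v a / 2"
  define v1 where "v1 = 2 * (s * poly v a)"
  define u0 where "u0 = s * poly u a / 2"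
  define u1 where "u1 = 2 * (s * poly u a)"
  have pos: "v0 > 0" "v1 > 0" "u0 > 0" "u1 > 0"
    using v u by (auto simp: v0_def v1_def u0_def u1_def)
  obtain d1 where d1: "d1 > 0"
    "\<And>x. \<bar>x - a\<bar> \<le> d1 \<Longrightarrow> v0 \<le> s * poly v x \<and> s * poly v x \<le> v1"
    by (rule poly_local_bounds[of "smult s v" a]) (use v in \<open>auto simp: v0_def v1_def\<close>)
  obtain d2 where d2: "d2 > 0"
    "\<And>x. \<bar>x - a\<bar> \<le> d2 \<Longrightarrow> u0 \<le> s * poly u x \<and> s * poly u x \<le> u1"
    by (rule poly_local_bounds[of "smult s u" a]) (use u in \<open>auto simp: u0_def u1_def\<close>)
  define \<delta> where "\<delta> = min (min d1 d2) 1"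
  have \<delta>: "0 < \<delta>" "\<delta> \<le> 1" using d1(1) d2(1) by (auto simp: \<delta>_def)
  have vb: "v0 \<le> s * poly v x" "s * poly v x \<le> v1" if "\<bar>x - a\<bar> \<le> \<delta>" for x
    using d1(2)[of x] that by (auto simp: \<delta>_def)
  have ub: "u0 \<le> s * poly u x" "s * poly u x \<le> u1" if "\<bar>x - a\<bar> \<le> \<delta>" for x
    using d2(2)[of x] that by (auto simp: \<delta>_def)
  have f_z: "poly f x = (s * (x - a)) ^ m * (s * poly u x)" for x
    using s_power[OF \<open>odd m\<close>] s_cases by (auto simp: f_def poly_power power_mult_distrib)
  have h_z: "poly h x = (s * (x - a)) ^ k * (s * poly v x)" for x
    using s_power[OF \<open>odd k\<close>] s_cases by (auto simp: h_def poly_power power_mult_distrib)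
  have z_abs: "\<bar>s * (x - a)\<bar> = \<bar>x - a\<bar>" for x
    using s by (simp add: abs_mult)
  define q where "q = (\<lambda>n. pcompose (fejer_poly n) [:- s * a, s:])"
  have q_z: "poly (q n) x = poly (fejer_poly n) (s * (x - a))" for n x
    by (simp add: q_def poly_pcompose algebra_simps)
  have even_km: "even (k - m)" using \<open>odd k\<close> \<open>odd m\<close> by simp
  have k_split: "z ^ k = z ^ (k - m) * z ^ m" for z :: real
    using \<open>m < k\<close> by (simp add: power_add[symmetric])
  define b1 where "b1 = min a (a - s * \<delta> / 2)"
  define b2 where "b2 = max a (a - s * \<delta> / 2)"
  have J: "b1 \<le> b2" "0 < \<delta> / 2" using \<delta> by (auto simp: b1_def b2_def)
  have in_J: "x \<in> {b1..b2} \<longleftrightarrow> - \<delta> / 2 \<le> s * (x - a) \<and> s * (x - a) \<le> 0" for x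
    using s_cases \<delta> by (auto simp: b1_def b2_def)
  have in_U: "x \<in> {b1 - \<delta> / 2<..<b2 + \<delta> / 2} \<longleftrightarrow> - \<delta> < s * (x - a) \<and> s * (x - a) < \<delta> / 2" for x
    using s_cases \<delta> by (auto simp: b1_def b2_def)
  have "\<exists>g C. exp_bounded g \<and> module_family np p g \<and>
         (\<forall>n>0. \<forall>x. \<bar>x\<bar> \<le> R \<longrightarrow>
            poly (g n) x \<le> \<theta> * max 0 (poly f x) + C / (real n)\<^sup>2 \<and>
            (x \<in> {a - \<delta> / 2<..<a + \<delta> / 2} \<and> poly f x < 0 \<longrightarrow>
              poly (g n) x \<le> poly f x + C / (real n)\<^sup>2))"
    if \<theta>: "\<theta> > 0" for \<theta> :: real
  proof -
    \<comment> \<open>With this value the bound \<open>\<alpha> (2 / z)\<^sup>k\<^sup>-\<^sup>m v\<^sub>1 z\<^sup>k\<close> for \<open>z > 0\<close> equals \<open>\<theta> u\<^sub>0 z\<^sup>m\<close>.\<close>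
    define \<alpha> where "\<alpha> = \<theta> * u0 / (2 ^ (k - m) * v1)"
    have \<alpha>: "\<alpha> > 0" using \<theta> pos by (simp add: \<alpha>_def)
    \<comment> \<open>For \<open>A \<ge> 1\<close> one has \<open>A\<^sup>k\<^sup>-\<^sup>m \<ge> A\<close>, so it suffices that \<open>\<alpha> A v\<^sub>0 \<ge> u\<^sub>1\<close>.\<close>
    define A where "A = max 1 (u1 / (\<alpha> * v0))"
    have A: "A \<ge> 1" "u1 \<le> \<alpha> * A * v0"
    proof -
      have "u1 / (\<alpha> * v0) \<le> A" unfolding A_def by simp
      then show "u1 \<le> \<alpha> * A * v0" using \<alpha> pos by (simp add: field_simps)
    qed (simp add: A_def)
    define g0 where "g0 = (\<lambda>n. [:\<alpha>:] * q n ^ (k - m) * h)"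
    have poly_g0: "poly (g0 n) x = \<alpha> * poly (q n) x ^ (k - m) * poly h x" for n x
      by (simp add: g0_def poly_power)
    have q_exp: "exp_bounded q"
      unfolding q_def by (rule exp_bounded_fejer_poly[OF s])
    have g0_exp: "exp_bounded g0"
      unfolding g0_def by (intro exp_bounded_mult exp_bounded_const exp_bounded_power q_exp)
    have g0_mod: "module_family np p g0"
      unfolding g0_def
      by (intro module_family_nonneg_mult exp_bounded_mult exp_bounded_const exp_bounded_power
          q_exp module_family_const[OF h])
        (use \<alpha> even_km in \<open>auto simp: poly_power zero_le_even_power\<close>)
    obtain \<omega> where \<omega>: "exp_bounded \<omega>" "\<And>n x. 0 \<le> poly (\<omega> n) x"
      "\<And>n x. x \<in> {b1..b2} \<Longrightarrow> 1 \<le> poly (\<omega> n) x"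
      "\<And>n x. \<bar>x\<bar> \<le> R \<Longrightarrow> x \<notin> {b1..b2} \<Longrightarrow> poly (\<omega> n) x \<le> 1"
      "\<And>n x. n > 0 \<Longrightarrow> \<bar>x\<bar> \<le> R \<Longrightarrow> x \<notin> {b1 - \<delta> / 2<..<b2 + \<delta> / 2} \<Longrightarrow>
         poly (\<omega> n) x * \<bar>poly (g0 n) x\<bar> \<le> 1 / (real n)\<^sup>2"
      by (rule localizing_family[OF g0_exp J]) blast
    define g where "g = (\<lambda>n. \<omega> n * g0 n)"
    have poly_g: "poly (g n) x = poly (\<omega> n) x * poly (g0 n) x" for n x
      by (simp add: g_def)
    have g0_left: "poly (g0 n) x \<le> - (\<alpha> * poly (q n) x ^ (k - m) * \<bar>x - a\<bar> ^ k * v0)"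
      if "s * (x - a) \<le> 0" "\<bar>x - a\<bar> \<le> \<delta>" for n x
    proof -
      have "(s * (x - a)) ^ k = - (\<bar>x - a\<bar> ^ k)"
        using that(1) \<open>odd k\<close> by (simp add: z_abs[symmetric])
      then have "poly h x \<le> - (\<bar>x - a\<bar> ^ k * v0)"
        using vb[OF that(2)] unfolding h_z by (auto intro!: mult_left_mono)
      then have "\<alpha> * poly (q n) x ^ (k - m) * poly h x \<le> \<alpha> * poly (q n) x ^ (k - m) * - (\<bar>x - a\<bar> ^ k * v0)"
        using \<alpha> even_km by (intro mult_left_mono mult_nonneg_nonneg) (auto simp: zero_le_even_power)
      then show ?thesis unfolding poly_g0 by (simp add: mult.assoc)
    qed
    have g_left: "poly (g n) x \<le> 0" if "s * (x - a) \<le> 0" "\<bar>x - a\<bar> \<le> \<delta>" for n x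
    proof -
      have "0 \<le> \<alpha> * poly (q n) x ^ (k - m) * \<bar>x - a\<bar> ^ k * v0"
        using \<alpha> pos even_km by (intro mult_nonneg_nonneg) (auto simp: zero_le_even_power)
      then show ?thesis
        unfolding poly_g using \<omega>(2)[of n x] g0_left[OF that, of n] by (intro mult_nonneg_nonpos) auto
    qed
    have g_right: "poly (g n) x \<le> \<theta> * poly f x"
      if "0 < s * (x - a)" "\<bar>x - a\<bar> \<le> \<delta>" "\<bar>x\<bar> \<le> R" for n x
    proof -
      define z where "z = s * (x - a)"
      have z: "0 < z" "z \<le> 2" using that z_abs[of x] \<delta> by (auto simp: z_def)
      have h1: "0 \<le> poly h x" "poly h x \<le> z ^ k * v1"
        using vb[OF that(2)] pos z unfolding h_z z_def[symmetric] by (auto intro!: mult_nonneg_nonneg mult_left_mono)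
      have q1: "0 \<le> poly (q n) x" "poly (q n) x \<le> 2 / z"
        using fejer_poly_bounds_right[OF z] unfolding q_z z_def[symmetric] by auto
      have "poly (q n) x ^ (k - m) * poly h x \<le> (2 / z) ^ (k - m) * (z ^ k * v1)"
        using h1 q1 z by (intro mult_mono power_mono) auto
      also have "\<dots> = 2 ^ (k - m) * v1 * z ^ m"
        using z unfolding k_split by (simp add: power_divide)
      finally have "\<alpha> * (poly (q n) x ^ (k - m) * poly h x) \<le> \<alpha> * (2 ^ (k - m) * v1 * z ^ m)"
        using \<alpha> by (intro mult_left_mono) auto
      also have "\<dots> = \<theta> * (z ^ m * u0)"
        using pos by (simp add: \<alpha>_def)
      also have "\<dots> \<le> \<theta> * (z ^ m * (s * poly u x))"
        using ub[OF that(2)] \<theta> z by (intro mult_left_mono) auto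
      finally have le: "poly (g0 n) x \<le> \<theta> * poly f x"
        unfolding poly_g0 f_z z_def[symmetric] by (simp add: mult.assoc)
      have "x \<notin> {b1..b2}" using that(1) unfolding in_J by simp
      then have "poly (\<omega> n) x * poly (g0 n) x \<le> 1 * poly (g0 n) x"
        using \<omega>(4)[OF that(3)] h1 q1 \<alpha> unfolding poly_g0 by (intro mult_right_mono) auto
      then show ?thesis using le unfolding poly_g by simp
    qed
    have upper: "poly (g n) x \<le> \<theta> * max 0 (poly f x) + (1 + u1 * A) / (real n)\<^sup>2"
      if n: "n > 0" and x: "\<bar>x\<bar> \<le> R" for n x
    proof -
      have C: "0 \<le> 1 / (real n)\<^sup>2" "1 / (real n)\<^sup>2 \<le> (1 + u1 * A) / (real n)\<^sup>2"
        using pos A(1) by (auto intro!: divide_right_mono)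
      have f: "0 \<le> \<theta> * max 0 (poly f x)" "\<theta> * poly f x \<le> \<theta> * max 0 (poly f x)"
        using \<theta> by (auto intro!: mult_left_mono)
      consider "x \<notin> {b1 - \<delta> / 2<..<b2 + \<delta> / 2}" | "\<bar>x - a\<bar> \<le> \<delta>" "s * (x - a) \<le> 0"
        | "\<bar>x - a\<bar> \<le> \<delta>" "0 < s * (x - a)"
        unfolding in_U z_abs[of x, symmetric] using \<delta> by linarith
      then show ?thesis
      proof cases
        case 1
        have "poly (g n) x \<le> poly (\<omega> n) x * \<bar>poly (g0 n) x\<bar>"
          unfolding poly_g using \<omega>(2) by (intro mult_left_mono) auto
        then show ?thesis using \<omega>(5)[OF n x 1] C f by linarith
      next
        case 2
        then show ?thesis using g_left[of x n] C f by linarith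
      next
        case 3
        then show ?thesis using g_right[of x n] x C f by linarith
      qed
    qed
    have near: "poly (g n) x \<le> poly f x + (1 + u1 * A) / (real n)\<^sup>2"
      if n: "n > 0" and x: "\<bar>x - a\<bar> < \<delta> / 2" "poly f x < 0" for n x
    proof -
      define t where "t = \<bar>x - a\<bar>"
      have x\<delta>: "\<bar>x - a\<bar> \<le> \<delta>" using x(1) \<delta> by linarith
      have z: "s * (x - a) < 0"
      proof (rule ccontr)
        assume "\<not> s * (x - a) < 0"
        then have "0 \<le> poly f x"
          unfolding f_z using ub[OF x\<delta>] pos by (intro mult_nonneg_nonneg[OF zero_le_power]) linarith+
        with x(2) show False by simp
      qed
      have t: "0 \<le> t" "t \<le> 1" using x(1) \<delta> by (auto simp: t_def)
      have zt: "s * (x - a) = - t" using z z_abs[of x] by (simp add: t_def)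
      have f_lower: "- (u1 * t ^ m) \<le> poly f x"
      proof -
        have "t ^ m * (s * poly u x) \<le> t ^ m * u1"
          using ub[OF x\<delta>] t by (intro mult_left_mono) auto
        then show ?thesis
          unfolding f_z zt using \<open>odd m\<close> by (simp add: mult.commute)
      qed
      show ?thesis
      proof (cases "t < A / (real n)\<^sup>2")
        case True
        have "t ^ m \<le> t ^ 1"
          using t \<open>odd m\<close> by (intro power_decreasing) (auto simp: odd_pos Suc_leI)
        then have "u1 * t ^ m \<le> u1 * (A / (real n)\<^sup>2)"
          using pos True by (intro mult_left_mono) auto
        also have "\<dots> \<le> (1 + u1 * A) / (real n)\<^sup>2"
          by (simp add: divide_right_mono)
        finally show ?thesis
          using f_lower g_left[of x n] z x\<delta> by linarith
      next
        case False
        then have "A \<le> (real n)\<^sup>2 * t"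
          using n by (simp add: field_simps)
        then have "A ^ (k - m) \<le> ((real n)\<^sup>2 * t) ^ (k - m)"
          using A by (intro power_mono) auto
        moreover have "A ^ 1 \<le> A ^ (k - m)"
          using A \<open>m < k\<close> by (intro power_increasing) auto
        ultimately have "A \<le> ((real n)\<^sup>2 * t) ^ (k - m)" by simp
        also have "\<dots> \<le> (poly (q n) x * t) ^ (k - m)"
          using fejer_poly_bound_left[of "s * (x - a)" n] z t unfolding q_z
          by (intro power_mono mult_right_mono) auto
        finally have "A \<le> poly (q n) x ^ (k - m) * t ^ (k - m)"
          by (simp add: power_mult_distrib)
        then have "\<alpha> * v0 * t ^ m * A \<le> \<alpha> * v0 * t ^ m * (poly (q n) x ^ (k - m) * t ^ (k - m))"
          using \<alpha> pos t by (intro mult_left_mono) auto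
        moreover have "u1 * t ^ m \<le> \<alpha> * A * v0 * t ^ m"
          using A t by (intro mult_right_mono) auto
        ultimately have "u1 * t ^ m \<le> \<alpha> * poly (q n) x ^ (k - m) * t ^ k * v0"
          unfolding k_split by (simp add: mult_ac)
        then have 1: "poly (g0 n) x \<le> - (u1 * t ^ m)"
          using g0_left[of x n] z x\<delta> unfolding t_def by linarith
        also have "\<dots> \<le> 0" using pos t by simp
        finally have 2: "poly (g0 n) x \<le> 0" .
        have "x \<in> {b1..b2}"
          using z x(1) unfolding in_J z_abs[of x, symmetric] by linarith
        then have "poly (\<omega> n) x * poly (g0 n) x \<le> 1 * poly (g0 n) x"
          using \<omega>(3) 2 by (intro mult_right_mono_neg) auto
        then have "poly (g n) x \<le> poly f x + 0"
          using 1 f_lower unfolding poly_g by simp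
        also have "\<dots> \<le> poly f x + (1 + u1 * A) / (real n)\<^sup>2"
          using pos A(1) by (intro add_left_mono) auto
        finally show ?thesis .
      qed
    qed
    have V: "\<bar>x - a\<bar> < \<delta> / 2" if "x \<in> {a - \<delta> / 2<..<a + \<delta> / 2}" for x
      using that unfolding abs_less_iff greaterThanLessThan_iff by linarith
    have "exp_bounded g" "module_family np p g"
      unfolding g_def using \<omega>(1,2) g0_exp g0_mod
      by (auto intro: exp_bounded_mult module_family_nonneg_mult)
    then show ?thesis
      using upper near V by blast
  qed
  moreover have "open {a - \<delta> / 2<..<a + \<delta> / 2}" "a \<in> {a - \<delta> / 2<..<a + \<delta> / 2}"
    using \<delta> by auto
  ultimately show ?thesis
    unfolding local_certificate_def by blast
qed

text \<open>
  Multiplication by an even power of \<open>x - a\<close> raises the order of vanishing of \<open>h\<close> above that of \<open>f\<close>.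
\<close>
lemma local_certificate_odd_order:
  assumes h: "[:-a, 1:] ^ k * v \<in> truncated_quadratic_module np p r"
    and f: "f = [:-a, 1:] ^ m * u" and "odd k" "odd m"
    and "\<bar>s\<bar> = 1" "s * poly v a > 0" "s * poly u a > 0"
  shows "local_certificate np p f R a"
proof (rule local_certificate_higher_odd_order[OF refl _ f])
  have "[:-a, 1:] ^ (m + 1) * ([:-a, 1:] ^ k * v) \<in> truncated_quadratic_module np p (m + 1 + r)"
    using \<open>odd m\<close> by (intro truncated_quadratic_module_sos_mult h)
      (auto simp: sos_polys_iff_nonneg poly_power zero_le_even_power degree_power_eq simp del: power_Suc)
  then show "[:-a, 1:] ^ (m + 1 + k) * v \<in> truncated_quadratic_module np p (m + 1 + r)"
    by (simp only: power_add mult.assoc)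
qed (use assms in auto)

section \<open>Existence of local corrections\<close>

text \<open>
  At an isolated feasible point one constraint may fail on the right and another one on the left, both
  with a change of sign. After the orders are made equal to \<open>k\<close> and the leading coefficients at
  \<open>a\<close> are normalised to \<open>-1\<close> and \<open>1\<close>, the sum cancels in order \<open>k\<close>. Weighting the first summand with the square
  of \<open>1 + C (x - a)\<close> gives the next coefficient the value \<open>- 2 C\<close> plus a constant, which is negative
  for large \<open>C\<close>; the new order \<open>k + 1\<close> is even.
\<close>
lemma even_order_combination:
  fixes v1 v2 :: "real poly"
  assumes h1: "[:-a, 1:] ^ k1 * v1 \<in> truncated_quadratic_module np p r1"
    and h2: "[:-a, 1:] ^ k2 * v2 \<in> truncated_quadratic_module np p r2"
    and odd: "odd k1" "odd k2" and v: "poly v1 a < 0" "poly v2 a > 0"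
  obtains r k w where "[:-a, 1:] ^ k * w \<in> truncated_quadratic_module np p r" "even k" "poly w a < 0"
proof -
  define l where "l = [:-a, 1:]"
  \<comment> \<open>A common order from which both \<open>k\<^sub>1\<close> and \<open>k\<^sub>2\<close> differ by an even number.\<close>
  define k where "k = k1 + k2 + 1"
  define c1 where "c1 = - 1 / poly v1 a"
  define c2 where "c2 = 1 / poly v2 a"
  have c: "c1 > 0" "c2 > 0" using v by (auto simp: c1_def c2_def divide_neg_neg)
  define V1 where "V1 = smult c1 v1"
  define V2 where "V2 = smult c2 v2"
  have V: "poly V1 a = - 1" "poly V2 a = 1"
    using v by (auto simp: V1_def V2_def c1_def c2_def)
  define C where "C = \<bar>poly (pderiv V1) a\<bar> + \<bar>poly (pderiv V2) a\<bar> + 1"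
  define m where "m = 1 + smult C l"
  define S where "S = m\<^sup>2 * V1 + V2"
  have la: "poly l x = x - a" for x by (simp add: l_def)
  have m: "poly m a = 1" "poly (pderiv m) a = C"
    by (auto simp: m_def la pderiv_add pderiv_smult pderiv_1 l_def pderiv_pCons)
  have "poly S a = 0" by (simp add: S_def V m)
  then obtain w where w: "S = l * w"
    unfolding poly_eq_0_iff_dvd l_def by (elim dvdE)
  have "poly (pderiv S) a = poly w a"
    unfolding w by (simp add: pderiv_mult la) (simp add: l_def pderiv_pCons)
  moreover have "poly (pderiv S) a = - (2 * C) + poly (pderiv V1) a + poly (pderiv V2) a"
    by (simp add: S_def pderiv_add pderiv_mult pderiv_power power2_eq_square m V)
  moreover have "C > 0" unfolding C_def by simp
  ultimately have wa: "poly w a < 0"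
    unfolding C_def by argo
  have deg_l1: "degree l = 1" by (simp add: l_def)
  have deg_l: "degree (l ^ j) = j" for j
    by (simp add: l_def degree_power_eq)
  have deg_m: "degree m \<le> 1"
    unfolding m_def by (intro degree_add_le) (auto simp: l_def)
  have sos1: "m\<^sup>2 * [:c1:] * l ^ (k2 + 1) \<in> sos_polys" and sos2: "[:c2:] * l ^ (k1 + 1) \<in> sos_polys"
    using odd c by (auto simp: sos_polys_iff_nonneg poly_power zero_le_even_power simp del: power_Suc
        intro!: mult_nonneg_nonneg)
  have "degree (m\<^sup>2 * [:c1:] * l ^ (k2 + 1)) \<le> degree m * 2 + 0 + (k2 + 1)"
    by (intro order_trans[OF degree_mult_le] add_mono order_trans[OF degree_power_le]) (auto simp: deg_l deg_l1 simp del: power_Suc)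
  then have d1: "degree (m\<^sup>2 * [:c1:] * l ^ (k2 + 1)) \<le> 2 * (k2 + 2)"
    using deg_m by simp
  have "degree ([:c2:] * l ^ (k1 + 1)) \<le> 0 + (k1 + 1)"
    by (intro order_trans[OF degree_mult_le] add_mono) (auto simp: deg_l deg_l1 simp del: power_Suc)
  then have d2: "degree ([:c2:] * l ^ (k1 + 1)) \<le> 2 * (k1 + 1)"
    by simp
  define H where "H = (m\<^sup>2 * [:c1:] * l ^ (k2 + 1)) * (l ^ k1 * v1) + ([:c2:] * l ^ (k1 + 1)) * (l ^ k2 * v2)"
  have "H \<in> truncated_quadratic_module np p (k2 + 2 + r1 + (k1 + 1 + r2))"
    unfolding H_def
    by (intro truncated_quadratic_module_add
        truncated_quadratic_module_mono[OF truncated_quadratic_module_sos_mult[OF h1[folded l_def] sos1 d1]]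
        truncated_quadratic_module_mono[OF truncated_quadratic_module_sos_mult[OF h2[folded l_def] sos2 d2]]) auto
  moreover have "H = l ^ k * S"
    by (simp add: H_def S_def V1_def V2_def k_def power_add algebra_simps)
  then have "H = l ^ (k + 1) * w"
    unfolding w by (simp add: mult_ac)
  moreover have "even (k + 1)" using odd by (simp add: k_def)
  ultimately show thesis
    using that wa unfolding l_def by metis
qed

lemma poly_positive_beside_root:
  fixes q :: "real poly"
  assumes "0 < s ^ k * poly q a"
  shows "\<forall>\<^sub>F z in at_right 0. 0 < poly ([:-a, 1:] ^ k * q) (a + s * z)"
proof -
  have "((\<lambda>z. s ^ k * poly q (a + s * z)) \<longlongrightarrow> s ^ k * poly q (a + s * 0)) (at_right 0)"
    by (intro tendsto_intros)
  then have "\<forall>\<^sub>F z in at_right 0. 0 < s ^ k * poly q (a + s * z)"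
    using assms by (intro order_tendstoD(1)) auto
  moreover have "\<forall>\<^sub>F z in at_right 0. 0 < (z::real)"
    by (rule eventually_at_right_less)
  ultimately show ?thesis
  proof eventually_elim
    case (elim z)
    then have "0 < z ^ k * (s ^ k * poly q (a + s * z))" by simp
    then show ?case by (simp add: poly_power power_mult_distrib mult_ac)
  qed
qed

lemma order_factorization:
  fixes q :: "real poly"
  assumes "q \<noteq> 0"
  obtains k v where "q = [:-a, 1:] ^ k * v" "poly v a \<noteq> 0"
  using order_decomp[OF assms, of a] unfolding poly_eq_0_iff_dvd by blast

text \<open>
  Next to \<open>a\<close>, on the side \<open>s\<close>, every polynomial has a constant sign. If no constraint were negative
  there, the points of this side would be feasible although \<open>f\<close> is negative at them.
\<close>
lemma violated_constraint_beside:
  assumes nonneg: "\<And>x. x \<in> feasible_set np p \<Longrightarrow> 0 \<le> poly f x"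
    and f: "f = [:-a, 1:] ^ m * u" "s ^ m * poly u a < 0" and s: "s \<noteq> 0"
  obtains i k v where "i \<in> {1..np}" "p i = [:-a, 1:] ^ k * v" "s ^ k * poly v a < 0"
proof -
  have "\<exists>i\<in>{1..np}. \<exists>k v. p i = [:-a, 1:] ^ k * v \<and> s ^ k * poly v a < 0"
  proof (rule ccontr)
    assume contra: "\<not> ?thesis"
    have "\<forall>\<^sub>F z in at_right 0. 0 \<le> poly (p i) (a + s * z)" if i: "i \<in> {1..np}" for i
    proof (cases "p i = 0")
      case False
      then obtain k v where kv: "p i = [:-a, 1:] ^ k * v" "poly v a \<noteq> 0"
        by (rule order_factorization)
      with contra i s have "0 < s ^ k * poly v a"
        by (metis linorder_neqE_linordered_idom mult_eq_0_iff power_not_zero)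
      from poly_positive_beside_root[OF this] show ?thesis
        unfolding kv(1) by (rule eventually_mono) simp
    qed simp
    then have "\<forall>\<^sub>F z in at_right 0. \<forall>i\<in>{1..np}. 0 \<le> poly (p i) (a + s * z)"
      by (intro eventually_ball_finite) auto
    moreover have "\<forall>\<^sub>F z in at_right 0. 0 < poly ([:-a, 1:] ^ m * (- u)) (a + s * z)"
      using f(2) by (intro poly_positive_beside_root) simp
    ultimately have "\<forall>\<^sub>F z in at_right (0::real). False"
    proof eventually_elim
      case (elim z)
      then have "a + s * z \<in> feasible_set np p" by (simp add: feasible_set_def)
      from nonneg[OF this] show ?case using elim(2) by (simp add: f(1))
    qed
    then show False by simp
  qed
  then show thesis using that by blast
qed

text \<open>
  The cases are: \<open>a\<close> infeasible; \<open>f\<close> nonnegative near \<open>a\<close>; \<open>f\<close> negative on both sides (even order \<open>m\<close>), where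
  the constraints that fail provide an element of even order, directly or by combination; and \<open>f\<close>
  negative on one side (odd \<open>m\<close>), where the constraint that fails there either has even order or is
  positive on the other side.
\<close>
proposition local_certificate_exists:
  assumes nonneg: "\<And>x. x \<in> feasible_set np p \<Longrightarrow> 0 \<le> poly f x"
  shows "local_certificate np p f R a"
proof (cases "a \<in> feasible_set np p")
  case False
  then obtain i where i: "i \<in> {1..np}" "poly (p i) a < 0"
    by (auto simp: feasible_set_def not_le)
  have "[:-a, 1:] ^ 0 * p i \<in> truncated_quadratic_module np p (degree (p i))"
    using truncated_quadratic_module_generator[OF i(1)] by simp
  then show ?thesis
    by (rule local_certificate_even_order) (use i in auto)
next
  case True
  then have fa: "0 \<le> poly f a" by (rule nonneg)
  show ?thesis
  proof (cases "f = 0")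
    case True
    then show ?thesis by (intro local_certificate_trivial[where V = UNIV]) auto
  next
    case False
    then obtain m u where f: "f = [:-a, 1:] ^ m * u" and ua: "poly u a \<noteq> 0"
      by (rule order_factorization)
    have generator: "[:-a, 1:] ^ k * v \<in> truncated_quadratic_module np p (degree (p i))"
      if "i \<in> {1..np}" "p i = [:-a, 1:] ^ k * v" for i k v
      unfolding that(2)[symmetric] by (rule truncated_quadratic_module_generator[OF that(1)])
    show ?thesis
    proof (cases "even m")
      case even: True
      show ?thesis
      proof (cases "poly u a > 0")
        case True
        then obtain \<delta> where \<delta>: "\<delta> > 0"
          "\<And>x. \<bar>x - a\<bar> \<le> \<delta> \<Longrightarrow> poly u a / 2 \<le> poly u x \<and> poly u x \<le> 2 * poly u a"
          by (rule poly_local_bounds) blast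
        have "0 \<le> poly f x" if "x \<in> ball a \<delta>" for x
        proof -
          have "\<bar>x - a\<bar> \<le> \<delta>" using that by (simp add: dist_real_def abs_minus_commute)
          then have "0 \<le> poly u x" using \<delta>(2)[of x] True by linarith
          then show ?thesis using even by (auto simp: f poly_power zero_le_even_power intro!: mult_nonneg_nonneg)
        qed
        then show ?thesis
          using \<delta>(1) by (intro local_certificate_trivial[where V = "ball a \<delta>"]) auto
      next
        case False
        then have neg: "poly u a < 0" using ua by simp
        obtain i1 k1 v1 where 1: "i1 \<in> {1..np}" "p i1 = [:-a, 1:] ^ k1 * v1" "1 ^ k1 * poly v1 a < 0"
          by (rule violated_constraint_beside[where s = 1, OF nonneg f]) (use neg in auto)
        obtain i2 k2 v2 where 2: "i2 \<in> {1..np}" "p i2 = [:-a, 1:] ^ k2 * v2" "(-1) ^ k2 * poly v2 a < 0"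
          by (rule violated_constraint_beside[where s = "- 1", OF nonneg f]) (use neg even in auto)
        consider "even k1" | "even k2" | "odd k1" "odd k2" by blast
        then show ?thesis
        proof cases
          case 3
          then have "poly v1 a < 0" "0 < poly v2 a" using 1(3) 2(3) by auto
          then obtain r k w where "[:-a, 1:] ^ k * w \<in> truncated_quadratic_module np p r" "even k" "poly w a < 0"
            by (rule even_order_combination[OF generator[OF 1(1,2)] generator[OF 2(1,2)] 3]) blast
          then show ?thesis using fa by (intro local_certificate_even_order) auto
        qed (use 1 2 fa generator in \<open>auto intro: local_certificate_even_order\<close>)
      qed
    next
      case odd: False
      define s :: real where "s = sgn (poly u a)"
      have s: "\<bar>s\<bar> = 1" "s * poly u a > 0" "s = 1 \<or> s = - 1"
        using ua by (auto simp: s_def sgn_if)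
      obtain i k v where i: "i \<in> {1..np}" "p i = [:-a, 1:] ^ k * v" "(- s) ^ k * poly v a < 0"
        by (rule violated_constraint_beside[where s = "- s", OF nonneg f]) (use s odd in auto)
      show ?thesis
      proof (cases "even k")
        case True
        then have "poly v a < 0" using i(3) s(3) by auto
        then show ?thesis
          using generator[OF i(1,2)] True fa by (intro local_certificate_even_order) auto
      next
        case False
        then have "s * poly v a > 0" using i(3) s(3) by auto
        then show ?thesis
          by (rule local_certificate_odd_order[OF generator[OF i(1,2)] f False odd s(1) _ s(2)])
      qed
    qed
  qed
qed

section \<open>Elements of the quadratic module that are negative at infinity\<close>

lemma poly_nonneg_near_at_top:
  fixes q :: "'i \<Rightarrow> real poly"
  assumes "finite I" "\<And>i. i \<in> I \<Longrightarrow> 0 \<le> lead_coeff (q i)"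
  obtains N where "\<And>x i. N \<le> x \<Longrightarrow> i \<in> I \<Longrightarrow> 0 \<le> poly (q i) x"
proof -
  have "\<forall>\<^sub>F x in at_top. 0 \<le> poly (q i) x" if "i \<in> I" for i
  proof (cases "q i = 0")
    case False
    then have pos: "0 < lead_coeff (q i)"
      using assms(2)[OF that] by (simp add: less_le)
    then obtain N where "\<forall>x\<ge>N. lead_coeff (q i) \<le> poly (q i) x"
      using poly_pinfty_gt_lc by blast
    then show ?thesis
      using pos unfolding eventually_at_top_linorder by (meson order_trans less_imp_le)
  qed simp
  then have "\<forall>\<^sub>F x in at_top. \<forall>i\<in>I. 0 \<le> poly (q i) x"
    using assms(1) by (intro eventually_ball_finite) auto
  then show thesis
    unfolding eventually_at_top_linorder using that by blast
qed

lemma lead_coeff_reflect_arg: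
  fixes q :: "real poly"
  shows "lead_coeff (pcompose q [:0, - 1:]) = lead_coeff q * (- 1) ^ degree q"
  by (subst lead_coeff_comp) auto

lemma poly_even_degree_negative:
  fixes h :: "real poly"
  assumes "even (degree h)" "lead_coeff h < 0"
  obtains N where "N \<ge> 1" "\<And>x. N \<le> \<bar>x\<bar> \<Longrightarrow> poly h x \<le> lead_coeff h"
proof -
  have "0 < lead_coeff (- h)" using assms(2) by simp
  then obtain N1 where N1: "\<forall>x\<ge>N1. lead_coeff (- h) \<le> poly (- h) x"
    using poly_pinfty_gt_lc by blast
  have lc: "lead_coeff (pcompose (- h) [:0, - 1:]) = - lead_coeff h"
    using assms(1) unfolding lead_coeff_reflect_arg by simp
  have "0 < lead_coeff (pcompose (- h) [:0, - 1:])"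
    unfolding lc using assms(2) by simp
  then obtain N2 where N2: "\<forall>x\<ge>N2. lead_coeff (pcompose (- h) [:0, - 1:]) \<le> poly (pcompose (- h) [:0, - 1:]) x"
    using poly_pinfty_gt_lc by blast
  show thesis
  proof (rule that[of "max (max N1 N2) 1"])
    fix x :: real assume x: "max (max N1 N2) 1 \<le> \<bar>x\<bar>"
    show "poly h x \<le> lead_coeff h"
    proof (cases "0 \<le> x")
      case True
      then show ?thesis using N1[rule_format, of x] x by simp
    next
      case False
      then show ?thesis using N2[rule_format, of "- x"] x unfolding lc by (simp add: poly_pcompose)
    qed
  qed simp
qed

text \<open>
  The counterpart at infinity of the combination for an isolated point: after the leading terms cancel, the
  coefficient of \<open>x\<^sup>k\<^sup>+\<^sup>1\<close> decides. With the weights \<open>(x - C)\<^sup>2\<close> and \<open>x\<^sup>2\<close> it is \<open>2 C\<close> plus a constant,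
  so it becomes negative for a sufficiently negative \<open>C\<close>, and \<open>k + 1\<close> is even.
\<close>
lemma even_degree_combination:
  fixes p1 p2 :: "real poly"
  assumes p1: "p1 \<in> truncated_quadratic_module np p r1" and p2: "p2 \<in> truncated_quadratic_module np p r2"
    and odd: "odd (degree p1)" "odd (degree p2)" and lc: "lead_coeff p1 < 0" "0 < lead_coeff p2"
  obtains r h where "h \<in> truncated_quadratic_module np p r" "even (degree h)" "lead_coeff h < 0"
proof -
  \<comment> \<open>A common degree from which both degrees differ by an even number.\<close>
  define k where "k = degree p1 + degree p2 + 1"
  define w1 where "w1 = monom (- 1 / lead_coeff p1) (degree p2 + 1)"
  define w2 where "w2 = monom (1 / lead_coeff p2) (degree p1 + 1)"
  have sos: "w1 \<in> sos_polys" "w2 \<in> sos_polys"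
  proof -
    have "0 \<le> x ^ (degree p1 + 1)" "0 \<le> x ^ (degree p2 + 1)" for x :: real
      using odd by (intro zero_le_even_power; simp)+
    moreover have "0 \<le> - 1 / lead_coeff p1" "0 \<le> 1 / lead_coeff p2"
      using lc by (auto intro: divide_nonpos_neg)
    ultimately show "w1 \<in> sos_polys" "w2 \<in> sos_polys"
      unfolding sos_polys_iff_nonneg w1_def w2_def poly_monom
      by (blast intro: mult_nonneg_nonneg)+
  qed
  define h1 where "h1 = w1 * p1"
  define h2 where "h2 = w2 * p2"
  have nz: "lead_coeff p1 \<noteq> 0" "lead_coeff p2 \<noteq> 0" using lc by auto
  have coeffs: "coeff h1 k = - 1" "coeff h2 k = 1" "\<And>j. j > k \<Longrightarrow> coeff h1 j = 0" "\<And>j. j > k \<Longrightarrow> coeff h2 j = 0"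
    using nz by (auto simp: h1_def h2_def w1_def w2_def k_def coeff_monom_mult coeff_eq_0)
  define C where "C = - (\<bar>coeff h1 (k - 1)\<bar> + \<bar>coeff h2 (k - 1)\<bar> + 1)"
  define h where "h = [:- C, 1:]\<^sup>2 * h1 + [:0, 1:]\<^sup>2 * h2"
  have h_eq: "h = [:C\<^sup>2, - 2 * C, 1:] * h1 + [:0, 0, 1:] * h2"
    by (simp add: h_def power2_eq_square)
  have k: "k = Suc (degree p1 + degree p2)" by (simp add: k_def)
  have coeff_h: "coeff h (Suc k) = coeff h1 (k - 1) + coeff h2 (k - 1) + 2 * C"
    unfolding h_eq using coeffs unfolding k by simp
  have coeff_h_top: "coeff h j = 0" if "j > Suc k" for j
  proof -
    obtain i where i: "j = Suc (Suc i)" "i \<ge> k" using \<open>j > Suc k\<close>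
      by (metis Suc_lessE Suc_less_eq less_Suc_eq_le less_imp_Suc_add)
    show ?thesis
      unfolding h_eq i(1) using coeffs i(2) by (cases "i = k") (auto simp: coeff_pCons)
  qed
  have neg: "coeff h (Suc k) < 0"
    unfolding coeff_h C_def by argo
  have "degree h = Suc k"
  proof (rule antisym)
    show "degree h \<le> Suc k" using coeff_h_top by (intro degree_le) auto
    show "Suc k \<le> degree h" using neg by (intro le_degree) auto
  qed
  moreover have "h \<in> truncated_quadratic_module np p (1 + (degree w1 + r1) + (1 + (degree w2 + r2)))"
  proof -
    have sq: "[:t, 1:]\<^sup>2 * q \<in> truncated_quadratic_module np p (1 + r)"
      if "q \<in> truncated_quadratic_module np p r" for t q r
      by (rule truncated_quadratic_module_sos_mult[OF that]) (auto simp: sos_polys_iff_nonneg degree_power_eq)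
    have "h1 \<in> truncated_quadratic_module np p (degree w1 + r1)"
      unfolding h1_def by (rule truncated_quadratic_module_sos_mult[OF p1 sos(1)]) simp
    moreover have "h2 \<in> truncated_quadratic_module np p (degree w2 + r2)"
      unfolding h2_def by (rule truncated_quadratic_module_sos_mult[OF p2 sos(2)]) simp
    ultimately show ?thesis
      unfolding h_def
      by (intro truncated_quadratic_module_add truncated_quadratic_module_mono[OF sq]) auto
  qed
  ultimately show thesis
    using that neg odd by (auto simp: k_def)
qed

text \<open>
  On each of the two ends of the line some constraint has a negative leading term, for otherwise the
  feasible set would be unbounded. A constraint of even degree with this property is negative at
  both ends; two of odd degree are combined.
\<close>
lemma negative_element_at_infinity:
  assumes bdd: "bounded (feasible_set np p)"
  obtains h r N c where "h \<in> truncated_quadratic_module np p r" "N \<ge> 1" "c > 0"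
    "\<And>x. N \<le> \<bar>x\<bar> \<Longrightarrow> poly h x \<le> - c"
proof -
  obtain b where b: "\<And>x. x \<in> feasible_set np p \<Longrightarrow> \<bar>x\<bar> \<le> b"
    using bdd unfolding bounded_iff by auto
  have "\<exists>i\<in>{1..np}. lead_coeff (p i) < 0"
  proof (rule ccontr)
    assume "\<not> ?thesis"
    then obtain N where N: "\<And>x i. N \<le> x \<Longrightarrow> i \<in> {1..np} \<Longrightarrow> 0 \<le> poly (p i) x"
      by (metis poly_nonneg_near_at_top[of "{1..np}" p] finite_atLeastAtMost not_le)
    then have "max N (\<bar>b\<bar> + 1) \<in> feasible_set np p" by (simp add: feasible_set_def)
    from b[OF this] show False by linarith
  qed
  then obtain i where i: "i \<in> {1..np}" "lead_coeff (p i) < 0" by blast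
  have "\<exists>j\<in>{1..np}. lead_coeff (pcompose (p j) [:0, - 1:]) < 0"
  proof (rule ccontr)
    assume "\<not> ?thesis"
    then obtain N where N: "\<And>x i. N \<le> x \<Longrightarrow> i \<in> {1..np} \<Longrightarrow> 0 \<le> poly (pcompose (p i) [:0, - 1:]) x"
      by (metis poly_nonneg_near_at_top[of "{1..np}" "\<lambda>i. pcompose (p i) [:0, - 1:]"] finite_atLeastAtMost not_le)
    then have "0 \<le> poly (p i) (- max N (\<bar>b\<bar> + 1))" if "i \<in> {1..np}" for i
      using N[OF _ that, of "max N (\<bar>b\<bar> + 1)"] by (simp add: poly_pcompose)
    then have "- max N (\<bar>b\<bar> + 1) \<in> feasible_set np p" by (simp add: feasible_set_def)
    from b[OF this] show False by linarith
  qed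
  then obtain j where j: "j \<in> {1..np}" "lead_coeff (p j) * (- 1) ^ degree (p j) < 0"
    unfolding lead_coeff_reflect_arg by blast
  note generators = i(1)[THEN truncated_quadratic_module_generator[of _ np p]]
    j(1)[THEN truncated_quadratic_module_generator[of _ np p]]
  have "\<exists>h r. h \<in> truncated_quadratic_module np p r \<and> even (degree h) \<and> lead_coeff h < 0"
  proof -
    consider "even (degree (p i))" | "even (degree (p j))" | "odd (degree (p i))" "odd (degree (p j))"
      by blast
    then show ?thesis
    proof cases
      case 3
      then have "0 < lead_coeff (p j)" using j(2) by simp
      then show ?thesis
        by (rule even_degree_combination[OF generators 3 i(2)]) blast
    qed (use i j generators in \<open>auto\<close>)
  qed
  then obtain h r where h: "h \<in> truncated_quadratic_module np p r" "even (degree h)" "lead_coeff h < 0"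
    by blast
  obtain N where "N \<ge> 1" "\<And>x. N \<le> \<bar>x\<bar> \<Longrightarrow> poly h x \<le> lead_coeff h"
    by (rule poly_even_degree_negative[OF h(2,3)]) blast
  then show thesis using that[OF h(1), of N "- lead_coeff h"] h(3) by simp
qed

section \<open>From local corrections to a global certificate\<close>

text \<open>
  Sum of the local certificates over a finite subcover. Where \<open>f < 0\<close>, one member brings the sum below
  \<open>f\<close> and the others add only \<open>O(1 / n\<^sup>2)\<close>; where \<open>f \<ge> 0\<close>, each member uses at most the share
  \<open>\<theta> f\<close>, and the shares add up to at most \<open>f\<close>.
\<close>
lemma interval_certificate:
  assumes nonneg: "\<And>x. x \<in> feasible_set np p \<Longrightarrow> 0 \<le> poly f x"
  obtains G C where "exp_bounded G" "module_family np p G"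
    "\<And>n x. n > 0 \<Longrightarrow> \<bar>x\<bar> \<le> R \<Longrightarrow> poly (G n) x \<le> poly f x + C / (real n)\<^sup>2"
proof -
  have "\<forall>a. local_certificate np p f R a"
    using local_certificate_exists[OF nonneg] by blast
  then obtain V where V: "\<And>a. open (V a)" "\<And>a. a \<in> V a"
    "\<And>a. \<forall>\<theta>>0. \<exists>g C. exp_bounded g \<and> module_family np p g \<and>
         (\<forall>n>0. \<forall>x. \<bar>x\<bar> \<le> R \<longrightarrow>
            poly (g n) x \<le> \<theta> * max 0 (poly f x) + C / (real n)\<^sup>2 \<and>
            (x \<in> V a \<and> poly f x < 0 \<longrightarrow> poly (g n) x \<le> poly f x + C / (real n)\<^sup>2))"
    unfolding local_certificate_def by metis
  have "compact {-R..R}" "{-R..R} \<subseteq> (\<Union>a\<in>{-R..R}. V a)"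
    using V(2) by auto
  then obtain A where A: "finite A" "{-R..R} \<subseteq> (\<Union>a\<in>A. V a)"
    using V(1) by (metis compactE_image)
  define \<theta> where "\<theta> = 1 / (real (card A) + 1)"
  have \<theta>: "\<theta> > 0" "real (card A) * \<theta> \<le> 1" by (auto simp: \<theta>_def field_simps)
  have "\<forall>a. \<exists>g C. exp_bounded g \<and> module_family np p g \<and>
         (\<forall>n>0. \<forall>x. \<bar>x\<bar> \<le> R \<longrightarrow>
            poly (g n) x \<le> \<theta> * max 0 (poly f x) + C / (real n)\<^sup>2 \<and>
            (x \<in> V a \<and> poly f x < 0 \<longrightarrow> poly (g n) x \<le> poly f x + C / (real n)\<^sup>2))"
    using V(3) \<theta>(1) by blast
  then obtain g C where gC: "\<And>a. exp_bounded (g a)" "\<And>a. module_family np p (g a)"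
    "\<And>a n x. n > 0 \<Longrightarrow> \<bar>x\<bar> \<le> R \<Longrightarrow> poly (g a n) x \<le> \<theta> * max 0 (poly f x) + C a / (real n)\<^sup>2"
    "\<And>a n x. n > 0 \<Longrightarrow> \<bar>x\<bar> \<le> R \<Longrightarrow> x \<in> V a \<Longrightarrow> poly f x < 0 \<Longrightarrow> poly (g a n) x \<le> poly f x + C a / (real n)\<^sup>2"
    by metis
  define G where "G = (\<lambda>n. \<Sum>a\<in>A. g a n)"
  have "poly (G n) x \<le> poly f x + sum C A / (real n)\<^sup>2" if n: "n > 0" and x: "\<bar>x\<bar> \<le> R" for n x
  proof (cases "poly f x < 0")
    case True
    have "x \<in> {-R..R}" using x by auto
    then obtain b where b: "b \<in> A" "x \<in> V b" using A(2) by blast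
    have "poly (G n) x = poly (g b n) x + (\<Sum>a\<in>A - {b}. poly (g a n) x)"
      using A(1) b(1) by (simp add: G_def poly_sum sum.remove)
    also have "\<dots> \<le> (poly f x + C b / (real n)\<^sup>2) + (\<Sum>a\<in>A - {b}. C a / (real n)\<^sup>2)"
      using gC(3)[OF n x] True by (intro add_mono gC(4)[OF n x b(2)] sum_mono) (simp_all add: max_def)
    also have "\<dots> = poly f x + sum C A / (real n)\<^sup>2"
      using sum.remove[OF A(1) b(1), of "\<lambda>a. C a / (real n)\<^sup>2"] by (simp add: sum_divide_distrib)
    finally show ?thesis .
  next
    case False
    have "poly (G n) x \<le> (\<Sum>a\<in>A. \<theta> * poly f x + C a / (real n)\<^sup>2)"
      unfolding G_def poly_sum using gC(3)[OF n x] False by (intro sum_mono) (simp add: max_def)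
    also have "\<dots> = (real (card A) * \<theta>) * poly f x + sum C A / (real n)\<^sup>2"
      by (simp add: sum.distrib sum_divide_distrib mult.assoc)
    also have "\<dots> \<le> 1 * poly f x + sum C A / (real n)\<^sup>2"
      using \<theta>(2) False by (intro add_right_mono mult_right_mono) auto
    finally show ?thesis by simp
  qed
  moreover have "exp_bounded G" "module_family np p G"
    unfolding G_def using gC(1,2) by (auto intro: exp_bounded_sum module_family_sum)
  ultimately show thesis using that by blast
qed

text \<open>
  Powers of \<open>(x / 2N)\<^sup>2\<close> with exponent proportional to \<open>n\<close> are exponentially small on \<open>[-N, N]\<close>, and
  beyond \<open>4 N\<^sup>2 = (2 N)\<^sup>2\<close> they outgrow any exponentially bounded family: there \<open>(x / 2N)\<^sup>2 \<ge> \<bar>x\<bar>\<close>.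
\<close>
lemma dominating_family_at_infinity:
  fixes N :: real
  assumes F: "exp_bounded F" and N: "N \<ge> 1"
  obtains \<omega> where "exp_bounded \<omega>" "\<And>n x. 0 \<le> poly (\<omega> n) x"
    "\<And>n x. n > 0 \<Longrightarrow> \<bar>x\<bar> \<le> N \<Longrightarrow> poly (\<omega> n) x \<le> 1 / (real n)\<^sup>2"
    "\<And>n x. n > 0 \<Longrightarrow> 4 * N\<^sup>2 \<le> \<bar>x\<bar> \<Longrightarrow> \<bar>poly (F n) x\<bar> \<le> poly (\<omega> n) x"
proof -
  obtain B where B: "B \<ge> 1"
    "\<And>n x. n > 0 \<Longrightarrow> \<bar>poly (F n) x\<bar> \<le> (real B * (1 + x\<^sup>2)) ^ (B * n)"
    using exp_boundedE[OF F] by metis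
  define w where "w = [:0, 1 / (2 * N):]\<^sup>2"
  have w: "poly w x = (x / (2 * N))\<^sup>2" for x by (simp add: w_def poly_power)
  \<comment> \<open>The base \<open>B (1 + x\<^sup>2)\<close> is at most \<open>(x\<^sup>2)\<^sup>B\<^sup>+\<^sup>2\<close>, and \<open>x\<^sup>2\<close> is at most the square of \<open>(x / 2N)\<^sup>2\<close>.\<close>
  define L where "L = 2 * ((B + 2) * B)"
  have L: "L \<ge> 1" using B(1) by (simp add: L_def)
  show thesis
  proof
    show "exp_bounded (\<lambda>n. w ^ (L * n))" by (rule exp_bounded_geometric)
    show "0 \<le> poly (w ^ (L * n)) x" for n x by (simp add: poly_power w)
    show "poly (w ^ (L * n)) x \<le> 1 / (real n)\<^sup>2" if n: "n > 0" and x: "\<bar>x\<bar> \<le> N" for n x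
    proof -
      have "\<bar>x / (2 * N)\<bar> \<le> 1 / 2" using N x by (simp add: field_simps)
      then have "\<bar>x / (2 * N)\<bar>\<^sup>2 \<le> (1 / 2)\<^sup>2" by (intro power_mono) auto
      then have "poly w x \<le> 1 / 4" by (simp add: w power_divide)
      then have "poly w x ^ (L * n) \<le> (1 / 4) ^ (L * n)"
        by (intro power_mono) (auto simp: w)
      also have "\<dots> \<le> (1 / 4) ^ n"
        using L by (intro power_decreasing) auto
      finally show ?thesis
        using quarter_power_le_inverse_square[OF n] by (simp add: poly_power)
    qed
    show "\<bar>poly (F n) x\<bar> \<le> poly (w ^ (L * n)) x" if n: "n > 0" and x: "4 * N\<^sup>2 \<le> \<bar>x\<bar>" for n x
    proof -
      have N2: "1 \<le> N\<^sup>2" using N by (simp add: one_le_power)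
      define y where "y = x\<^sup>2"
      have "(4 * N\<^sup>2)\<^sup>2 \<le> \<bar>x\<bar>\<^sup>2" using x N2 by (intro power_mono) auto
      then have yN: "(4 * N\<^sup>2)\<^sup>2 \<le> y" by (simp add: y_def)
      have "4\<^sup>2 \<le> (4 * N\<^sup>2)\<^sup>2" using N2 by (intro power_mono) auto
      then have y: "16 \<le> y" using yN by simp
      have "real B \<le> 2 ^ B" by (rule less_imp_le) (rule of_nat_less_two_power)
      also have "\<dots> \<le> y ^ B" using y by (intro power_mono) auto
      finally have "real B * (1 + y) \<le> y ^ B * y\<^sup>2"
        using y by (intro mult_mono) (auto simp: power2_eq_square intro: order_trans[of _ "2 * y"])
      then have base: "real B * (1 + x\<^sup>2) \<le> y ^ (B + 2)" unfolding y_def power_add .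
      have "y * (4 * N\<^sup>2)\<^sup>2 \<le> y * y" using y yN by (intro mult_left_mono) auto
      then have "y \<le> (y / (4 * N\<^sup>2))\<^sup>2"
        using N by (simp add: power_divide power2_eq_square field_simps)
      then have yw: "y \<le> (poly w x)\<^sup>2" by (simp add: w y_def power_divide power_mult_distrib)
      have "\<bar>poly (F n) x\<bar> \<le> (real B * (1 + x\<^sup>2)) ^ (B * n)" by (rule B(2)[OF n])
      also have "\<dots> \<le> (y ^ (B + 2)) ^ (B * n)"
        using base by (intro power_mono) auto
      also have "\<dots> = y ^ ((B + 2) * B * n)"
        by (simp add: power_mult[symmetric] mult.assoc del: power_add add_2_eq_Suc')
      also have "\<dots> \<le> ((poly w x)\<^sup>2) ^ ((B + 2) * B * n)"
        using yw y by (intro power_mono) auto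
      also have "\<dots> = poly (w ^ (L * n)) x"
        by (simp only: L_def poly_power power_mult[symmetric] mult.assoc)
      finally show ?thesis .
    qed
  qed
qed

text \<open>
  The sum \<open>G\<close> of the local certificates makes \<open>f + O(1 / n\<^sup>2) - G\<close> nonnegative on \<open>[- 4 N\<^sup>2, 4 N\<^sup>2]\<close>. The
  member \<open>H\<close> of the module, the element that is negative at infinity times a dominating square, repairs the
  sign outside of this interval at the cost of another \<open>O(1 / n\<^sup>2)\<close> inside \<open>[-N, N]\<close>; in between, it
  is negative. The remainder is then nonnegative on the whole line, hence a sum of squares.
\<close>
theorem quadratic_rate_certificate:
  assumes bdd: "bounded (feasible_set np p)"
    and nonneg: "\<And>x. x \<in> feasible_set np p \<Longrightarrow> 0 \<le> poly f x"
  obtains C D where "C > 0"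
    "\<And>n. n > 0 \<Longrightarrow> f + [:C / (real n)\<^sup>2:] \<in> truncated_quadratic_module np p (D * n)"
proof -
  obtain h r N c where h: "h \<in> truncated_quadratic_module np p r" "N \<ge> 1" "c > 0"
    "\<And>x. N \<le> \<bar>x\<bar> \<Longrightarrow> poly h x \<le> - c"
    using negative_element_at_infinity[OF bdd] by metis
  obtain G C where G: "exp_bounded G" "module_family np p G"
    "\<And>n x. n > 0 \<Longrightarrow> \<bar>x\<bar> \<le> 4 * N\<^sup>2 \<Longrightarrow> poly (G n) x \<le> poly f x + C / (real n)\<^sup>2"
    using interval_certificate[OF nonneg] by metis
  define F where "F = (\<lambda>n. f + [:- 1:] * G n)"
  have F: "exp_bounded F"
    unfolding F_def by (intro exp_bounded_add exp_bounded_mult exp_bounded_const G(1))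
  obtain \<omega> where \<omega>: "exp_bounded \<omega>" "\<And>n x. 0 \<le> poly (\<omega> n) x"
    "\<And>n x. n > 0 \<Longrightarrow> \<bar>x\<bar> \<le> N \<Longrightarrow> poly (\<omega> n) x \<le> 1 / (real n)\<^sup>2"
    "\<And>n x. n > 0 \<Longrightarrow> 4 * N\<^sup>2 \<le> \<bar>x\<bar> \<Longrightarrow> \<bar>poly (F n) x\<bar> \<le> poly (\<omega> n) x"
    by (rule dominating_family_at_infinity[OF F h(2)]) blast
  obtain M where M: "M > 0" "\<And>x. \<bar>x\<bar> \<le> N \<Longrightarrow> \<bar>poly h x\<bar> \<le> M"
    using poly_bounded_on_interval by blast
  define H where "H = (\<lambda>n. ([:1 / c:] * \<omega> n) * h)"
  have scaled: "exp_bounded (\<lambda>n. [:1 / c:] * \<omega> n)"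
    by (intro exp_bounded_mult exp_bounded_const \<omega>(1))
  have H_exp: "exp_bounded H"
    unfolding H_def by (intro exp_bounded_mult scaled exp_bounded_const)
  have H_mod: "module_family np p H"
    unfolding H_def using \<omega>(2) h(3)
    by (intro module_family_nonneg_mult scaled module_family_const[OF h(1)]) auto
  have poly_H: "poly (H n) x = poly (\<omega> n) x * (poly h x / c)" for n x
    by (simp add: H_def)
  have H_inside: "poly (H n) x \<le> (M / c) / (real n)\<^sup>2" if "n > 0" "\<bar>x\<bar> \<le> N" for n x
  proof -
    have "poly h x / c \<le> M / c"
      using M(2)[OF that(2)] h(3) by (intro divide_right_mono) auto
    then have "poly (H n) x \<le> poly (\<omega> n) x * (M / c)"
      unfolding poly_H using \<omega>(2) by (intro mult_left_mono) auto
    also have "\<dots> \<le> 1 / (real n)\<^sup>2 * (M / c)"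
      using M(1) h(3) \<omega>(3)[OF that] by (intro mult_right_mono) auto
    finally show ?thesis by (simp add: mult.commute)
  qed
  have H_outside: "poly (H n) x \<le> - poly (\<omega> n) x" if "N \<le> \<bar>x\<bar>" for n x
  proof -
    have "poly h x / c \<le> - 1" using h(4)[OF that] h(3) by (simp add: field_simps)
    then have "poly (\<omega> n) x * (poly h x / c) \<le> poly (\<omega> n) x * (- 1)"
      using \<omega>(2) by (intro mult_left_mono) auto
    then show ?thesis by (simp add: poly_H)
  qed
  define C' where "C' = \<bar>C\<bar> + M / c"
  have C': "C' > 0" unfolding C'_def using M(1) h(3) by (intro add_nonneg_pos) auto
  define P where "P = (\<lambda>n. F n + [:- 1:] * H n + [:C' / (real n)\<^sup>2:])"
  have P_nonneg: "0 \<le> poly (P n) x" if n: "n > 0" for n x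
  proof -
    have poly_P: "poly (P n) x = poly f x - poly (G n) x - poly (H n) x + C' / (real n)\<^sup>2"
      by (simp add: P_def F_def)
    have div: "C' / (real n)\<^sup>2 = \<bar>C\<bar> / (real n)\<^sup>2 + (M / c) / (real n)\<^sup>2"
      "C / (real n)\<^sup>2 \<le> \<bar>C\<bar> / (real n)\<^sup>2" "0 \<le> \<bar>C\<bar> / (real n)\<^sup>2" "0 \<le> (M / c) / (real n)\<^sup>2"
      using M(1) h(3) by (auto simp: C'_def add_divide_distrib intro!: divide_right_mono)
    consider "\<bar>x\<bar> \<le> N" "\<bar>x\<bar> \<le> 4 * N\<^sup>2" | "N \<le> \<bar>x\<bar>" "\<bar>x\<bar> \<le> 4 * N\<^sup>2" | "4 * N\<^sup>2 \<le> \<bar>x\<bar>" "N \<le> \<bar>x\<bar>"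
    proof -
      have "N * 1 \<le> N * N" using h(2) by (intro mult_left_mono) auto
      then have "N \<le> 4 * N\<^sup>2" using h(2) unfolding power2_eq_square by linarith
      then show thesis using that by linarith
    qed
    then show ?thesis
    proof cases
      case 1
      then show ?thesis unfolding poly_P using G(3)[OF n 1(2)] H_inside[OF n 1(1)] div by linarith
    next
      case 2
      then show ?thesis
        unfolding poly_P using G(3)[OF n 2(2)] H_outside[OF 2(1), of n] \<omega>(2)[of n x] div by linarith
    next
      case 3
      have "\<bar>poly f x - poly (G n) x\<bar> \<le> poly (\<omega> n) x"
        using \<omega>(4)[OF n 3(1)] by (simp add: F_def)
      then show ?thesis
        unfolding poly_P using H_outside[OF 3(2), of n] div by linarith
    qed
  qed
  have "exp_bounded (\<lambda>n. F n + [:- 1:] * H n)"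
    by (intro exp_bounded_add exp_bounded_mult exp_bounded_const F H_exp)
  then obtain B where B: "\<And>n. n > 0 \<Longrightarrow> degree (F n + [:- 1:] * H n) \<le> B * n"
    unfolding exp_bounded_def by blast
  obtain D where D: "\<And>n. n > 0 \<Longrightarrow> G n + H n \<in> truncated_quadratic_module np p (D * n)"
    using module_family_add[OF G(2) H_mod] unfolding module_family_def by blast
  have "f + [:C' / (real n)\<^sup>2:] \<in> truncated_quadratic_module np p ((B + D) * n)" if n: "n > 0" for n
  proof -
    have "degree (P n) \<le> B * n"
      unfolding P_def by (rule degree_add_le[OF B[OF n]]) simp
    then have "P n \<in> truncated_quadratic_module np p (B * n)"
      using P_nonneg[OF n] by (intro truncated_quadratic_module_sos) (auto simp: sos_polys_iff_nonneg)
    then have "P n + (G n + H n) \<in> truncated_quadratic_module np p ((B + D) * n)"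
      by (intro truncated_quadratic_module_add[OF truncated_quadratic_module_mono[OF _ mult_le_mono1]
            truncated_quadratic_module_mono[OF D[OF n] mult_le_mono1]]) auto
    moreover have "P n + (G n + H n) = f + [:C' / (real n)\<^sup>2:]"
      by (simp add: P_def F_def)
    ultimately show ?thesis by simp
  qed
  then show thesis using that C' by blast
qed

section \<open>The error of the relaxation\<close>

lemma closed_feasible_set: "closed (feasible_set np p)"
proof -
  have "feasible_set np p = (\<Inter>i\<in>{1..np}. {x. 0 \<le> poly (p i) x})"
    by (auto simp: feasible_set_def)
  moreover have "closed {x. 0 \<le> poly q x}" for q :: "real poly"
    by (intro closed_Collect_le continuous_on_poly continuous_on_id continuous_on_const)
  ultimately show ?thesis by auto
qed

lemma min_value_attained:
  assumes "bounded (feasible_set np p)" "feasible_set np p \<noteq> {}"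
  obtains x0 where "x0 \<in> feasible_set np p" "min_value f np p = poly f x0"
    "\<And>x. x \<in> feasible_set np p \<Longrightarrow> min_value f np p \<le> poly f x"
proof -
  have "compact (feasible_set np p)"
    using assms(1) closed_feasible_set by (simp add: compact_eq_bounded_closed)
  then obtain x0 where x0: "x0 \<in> feasible_set np p" "\<And>x. x \<in> feasible_set np p \<Longrightarrow> poly f x0 \<le> poly f x"
    using continuous_attains_inf[of "feasible_set np p" "poly f"] assms(2)
      continuous_on_poly[OF continuous_on_id] by (metis (no_types))
  have "min_value f np p = poly f x0"
    unfolding min_value_def using x0 by (intro Least_equality) auto
  then show thesis using that x0 by simp
qed

theorem theorem1:
  fixes f :: "real poly" and np :: nat and p :: "nat \<Rightarrow> real poly"
  assumes "bounded (feasible_set np p)"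
    and "feasible_set np p \<noteq> {}"
  shows "\<exists>(C::real) (r0::nat). C > 0 \<and> admissible_order f np p r0 \<and>
           (\<forall>r\<ge>r0. 0 \<le> relaxation_error f np p r \<and>
                    relaxation_error f np p r \<le> ereal (C / (real r)\<^sup>2))"
proof -
  obtain x0 where x0: "x0 \<in> feasible_set np p" "min_value f np p = poly f x0"
    "\<And>x. x \<in> feasible_set np p \<Longrightarrow> min_value f np p \<le> poly f x"
    using min_value_attained[OF assms] by metis
  define \<mu> where "\<mu> = min_value f np p"
  have "0 \<le> poly (f - [:\<mu>:]) x" if "x \<in> feasible_set np p" for x
    using x0(3)[OF that] by (simp add: \<mu>_def)
  then obtain C D0 where C: "C > 0"
    "\<And>n. n > 0 \<Longrightarrow> f - [:\<mu>:] + [:C / (real n)\<^sup>2:] \<in> truncated_quadratic_module np p (D0 * n)"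
    using quadratic_rate_certificate[OF assms(1), of "f - [:\<mu>:]"] by metis
  \<comment> \<open>A positive slope, so that every \<open>r \<ge> D\<close> satisfies \<open>D n \<le> r < 2 D n\<close> for \<open>n = r div D \<ge> 1\<close>.\<close>
  define D where "D = Suc D0"
  define m where "m = Max (insert (degree f) ((\<lambda>i. degree (p i)) ` {1..np}))"
  define C' where "C' = C * (2 * real D)\<^sup>2"
  have lower: "0 \<le> relaxation_error f np p r" for r
  proof -
    have "sos_value f np p r \<le> ereal \<mu>"
      unfolding sos_value_def
    proof (rule Sup_least)
      fix y assume "y \<in> {ereal v |v. f - [:v:] \<in> truncated_quadratic_module np p r}"
      then obtain v where v: "y = ereal v" "f - [:v:] \<in> truncated_quadratic_module np p r" by blast
      show "y \<le> ereal \<mu>"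
        using truncated_quadratic_module_nonneg_on_feasible[OF v(2) x0(1)] x0(2) v(1) by (simp add: \<mu>_def)
    qed
    then show ?thesis
      unfolding relaxation_error_def \<mu>_def by (rule ereal_diff_positive)
  qed
  have upper: "relaxation_error f np p r \<le> ereal (C' / (real r)\<^sup>2)" if r: "D \<le> r" for r
  proof -
    define n where "n = r div D"
    have D: "D > 0" by (simp add: D_def)
    have n: "n > 0" using r D by (simp add: n_def div_greater_zero_iff)
    have "r < D * Suc n"
      using D dividend_less_times_div[of D r] by (simp add: n_def)
    also have "\<dots> \<le> 2 * D * n" using n by simp
    finally have "real r \<le> 2 * real D * real n"
      by (metis less_imp_le of_nat_le_iff of_nat_mult of_nat_numeral)
    then have "(real r)\<^sup>2 \<le> (2 * real D * real n)\<^sup>2"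
      by (intro power_mono) auto
    then have "C * (real r)\<^sup>2 \<le> C' * (real n)\<^sup>2"
      using C(1) by (simp add: C'_def power_mult_distrib mult.assoc)
    then have rate: "C / (real n)\<^sup>2 \<le> C' / (real r)\<^sup>2"
      using n r D by (simp add: field_simps)
    have "D0 * n \<le> D * n" by (simp add: D_def)
    also have "\<dots> \<le> r" by (simp add: n_def)
    finally have "f - [:\<mu>:] + [:C / (real n)\<^sup>2:] \<in> truncated_quadratic_module np p r"
      by (rule truncated_quadratic_module_mono[OF C(2)[OF n]])
    moreover have "f - [:\<mu>:] + [:C / (real n)\<^sup>2:] = f - [:\<mu> - C / (real n)\<^sup>2:]"
      by (simp add: diff_pCons)
    ultimately have "ereal (\<mu> - C / (real n)\<^sup>2) \<le> sos_value f np p r"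
      unfolding sos_value_def by (intro Sup_upper) auto
    then have "relaxation_error f np p r \<le> ereal \<mu> - ereal (\<mu> - C / (real n)\<^sup>2)"
      unfolding relaxation_error_def \<mu>_def by (intro ereal_minus_mono) auto
    also have "\<dots> \<le> ereal (C' / (real r)\<^sup>2)" using rate by simp
    finally show ?thesis .
  qed
  have "C' > 0" using C(1) by (simp add: C'_def D_def)
  moreover have "admissible_order f np p (max D m)"
    unfolding admissible_order_def m_def[symmetric] by simp
  moreover have "\<forall>r\<ge>max D m. 0 \<le> relaxation_error f np p r \<and>
      relaxation_error f np p r \<le> ereal (C' / (real r)\<^sup>2)"
    using lower upper by simp
  ultimately show ?thesis by blast
qed

end
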